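(* There exist universal constants $c,c'>0$ such that, for every $L,\mathcal G_0,D_{\mathcal Y}>0$, every $\sigma\ge0$, and every $\epsilon$ satisfying $$0<\epsilon\le c\min\{\sqrt{L\mathcal G_0},\,LD_{\mathcal Y}\},$$ there is an instance $f^{\rm sg}\in\mathcal F_{\rm NCC}^{\rm pd}(L,\mathcal G_0,D_{\mathcal Y})$ equipped with an unbiased stochastic first-order oracle whose mean-square error is at most $\sigma^2$, for which every adaptive stochastic zero-respecting algorithm requires at least $$c'\big(L^2D_{\mathcal Y}\mathcal G_0\,\epsilon^{-3}+L^3D_{\mathcal Y}^2\mathcal G_0\sigma^2\,\epsilon^{-6}\big)$$ (that is, $\Omega(L^2D_{\mathcal Y}\mathcal G_0\,\epsilon^{-3}+L^3D_{\mathcal Y}^2\mathcal G_0\sigma^2\,\epsilon^{-6})$) oracle calls to return an expected $\epsilon$-stationary output.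
   Context: All norms are Euclidean. For a vector $v$, $\operatorname{supp}(v)$ is the set of indices of its nonzero coordinates. For a nonempty closed convex set $C$, $\iota_C$ is its indicator function ($0$ on $C$, $+\infty$ off $C$) and $\mathsf P_C$ is Euclidean projection onto $C$. Function class. Given $L,\mathcal G_0,D_{\mathcal Y}>0$, $\mathcal F_{\rm NCC}^{\rm pd}(L,\mathcal G_0,D_{\mathcal Y})$ is the class of continuously differentiable functions $f:\mathcal X\times\mathcal Y\to\mathbb R$, over all finite dimensions $d_x,d_y$, where $\mathcal X\subset\mathbb R^{d_x}$, $\mathcal Y\subset\mathbb R^{d_y}$ are nonempty closed convex sets with $0\in\mathcal X$, $0\in\mathcal Y$, such that: (1) $\|\nabla f(x,y)-\nabla f(x',y')\|\le L\|(x,y)-(x',y')\|$ for all $(x,y),(x',y')\in\mathcal X\times\mathcal Y$ (joint gradient); (2) $f(x,\cdot)$ is concave on $\mathcal Y$ for every $x\in\mathcal X$; (3) $\operatorname{diam}(\mathcal Y):=\sup_{y,y'\in\mathcal Y}\|y-y'\|\le D_{\mathcal Y}$; (4) $\max_{y\in\mathcal Y}f(0,y)-\inf_{x\in\mathcal X}f(x,0)\le\mathcal G_0$. Stationarity. Let $\Phi_f(x):=\max_{y\in\mathcal Y}f(x,y)$ and $\varphi_f:=\Phi_f+\iota_{\mathcal X}$ on $\mathbb R^{d_x}$. The Moreau envelope is $(\varphi_f)_\lambda(x):=\min_{p\in\mathbb R^{d_x}}\{\varphi_f(p)+\frac1{2\lambda}\|p-x\|^2\}$. Since $\varphi_f$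 is $L$-weakly convex, for $0<\lambda<1/L$ the minimizer $p_\lambda(x)$ is unique, the envelope is continuously differentiable, and $\nabla(\varphi_f)_\lambda(x)=\lambda^{-1}(x-p_\lambda(x))$. A random output $x$ is expected $\epsilon$-stationary if $\mathbb E\|\nabla(\varphi_f)_{1/(2L)}(x)\|\le\epsilon$. Oracle. A stochastic first-order oracle for $f$ returns, at a query $(x,y)\in\mathcal X\times\mathcal Y$, the triple $(f(x,y),\widehat\nabla_xf(x,y;\xi),\widehat\nabla_yf(x,y;\xi))$, where $\xi$ is random. It is unbiased with mean-square error at most $\sigma^2$ if for every $(x,y)$, $\mathbb E_\xi[\widehat\nabla f(x,y;\xi)]=\nabla f(x,y)$ and $\mathbb E_\xi[\|\widehat\nabla f(x,y;\xi)-\nabla f(x,y)\|^2]\le\sigma^2$, where $\widehat\nabla f=(\widehat\nabla_xf,\widehat\nabla_yf)$. The random seeds $\xi_0,\xi_1,\dots$ at successive calls are independent and identically distributed, and $\xi_t$ is independent of the past transcript and of the current query. Algorithms. An adaptive stochastic zero-respecting algorithm starts at $(x^0,y^0)=(0,0)$, queries the oracle at $(x^0,y^0),(x^1,y^1),\dots$, and chooses each new iterate adaptively from the previous oracle responses so that, pathwise, $x^{t+1}=\mathsf P_{\mathcal X}(u)$ for some $u$ with $\operatorname{supp}(u)\subseteq\bigcup_{0\le i\le t}(\operatorname{supp}(x^i)\cup\operatorname{supp}(\widehat\nabla_xf(x^i,y^i;\xi_i)))$ and $y^{t+1}=\mathsf P_{\mathcal Y}(v)$ for some $v$ with $\operatorname{supp}(v)\subseteq\bigcup_{0\le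 i\le t}(\operatorname{supp}(y^i)\cup\operatorname{supp}(\widehat\nabla_yf(x^i,y^i;\xi_i)))$. The primal output after $q$ oracle calls (at $(x^0,y^0),\dots,(x^{q-1},y^{q-1})$) satisfies the same condition as a primal iterate: pathwise it equals $\mathsf P_{\mathcal X}(u)$ with $\operatorname{supp}(u)\subseteq\bigcup_{0\le i\le q-1}(\operatorname{supp}(x^i)\cup\operatorname{supp}(\widehat\nabla_xf(x^i,y^i;\xi_i)))$. "Universal constant" means a numerical constant independent of all problem parameters and dimensions. *)

theory Defs
  imports "HOL-Probability.Probability" "HOL-Library.Poly_Mapping"
begin

section \<open>Euclidean spaces of varying dimension\<close>

text \<open>
  The dimensions of an instance are existentially quantified inside the theorem, so they cannot be
  type indices. All vectors live in the inner product space of finitely supported real sequences,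
  and the Euclidean space of dimension \<open>d\<close> is the subspace of the vectors supported in
  \<open>{..<d}\<close>. Pairs carry the product norm, which is again Euclidean.
\<close>

abbreviation supp :: "('a \<Rightarrow>\<^sub>0 'b::zero) \<Rightarrow> 'a set" where
  "supp \<equiv> Poly_Mapping.keys"

abbreviation coord :: "('a \<Rightarrow>\<^sub>0 'b::zero) \<Rightarrow> 'a \<Rightarrow> 'b" where
  "coord \<equiv> Poly_Mapping.lookup"

instantiation poly_mapping :: (type, real_vector) real_vector
begin

lift_definition scaleR_poly_mapping :: "real \<Rightarrow> ('a \<Rightarrow>\<^sub>0 'b) \<Rightarrow> 'a \<Rightarrow>\<^sub>0 'b"
  is "\<lambda>r f i. r *\<^sub>R f i"
  by (erule finite_subset[rotated]) auto

instance
  by standard (transfer, simp add: fun_eq_iff algebra_simps)+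

end

instantiation poly_mapping :: (type, real_inner) real_inner
begin

definition inner_poly_mapping :: "('a \<Rightarrow>\<^sub>0 'b) \<Rightarrow> ('a \<Rightarrow>\<^sub>0 'b) \<Rightarrow> real" where
  "inner_poly_mapping u v = (\<Sum>i\<in>supp u. coord u i \<bullet> coord v i)"

definition norm_poly_mapping :: "('a \<Rightarrow>\<^sub>0 'b) \<Rightarrow> real" where
  "norm_poly_mapping u = sqrt (u \<bullet> u)"

definition dist_poly_mapping :: "('a \<Rightarrow>\<^sub>0 'b) \<Rightarrow> ('a \<Rightarrow>\<^sub>0 'b) \<Rightarrow> real" where
  "dist_poly_mapping u v = norm (u - v)"

definition sgn_poly_mapping :: "('a \<Rightarrow>\<^sub>0 'b) \<Rightarrow> 'a \<Rightarrow>\<^sub>0 'b" where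
  "sgn_poly_mapping u = u /\<^sub>R norm u"

definition uniformity_poly_mapping :: "(('a \<Rightarrow>\<^sub>0 'b) \<times> ('a \<Rightarrow>\<^sub>0 'b)) filter" where
  "uniformity_poly_mapping = (INF e\<in>{0 <..}. principal {(x, y). dist x y < e})"

definition open_poly_mapping :: "('a \<Rightarrow>\<^sub>0 'b) set \<Rightarrow> bool" where
  "open_poly_mapping U \<longleftrightarrow> (\<forall>x\<in>U. eventually (\<lambda>(x', y). x' = x \<longrightarrow> y \<in> U) uniformity)"

lemma inner_poly_mapping_superset:
  fixes u v :: "'a \<Rightarrow>\<^sub>0 'b"
  assumes "finite A" "supp u \<subseteq> A"
  shows "u \<bullet> v = (\<Sum>i\<in>A. coord u i \<bullet> coord v i)"
  unfolding inner_poly_mapping_def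
  by (rule sum.mono_neutral_left) (use assms in \<open>auto simp: in_keys_iff\<close>)

lemma lookup_scaleR_poly_mapping:
  "coord (r *\<^sub>R (u :: 'a \<Rightarrow>\<^sub>0 'b)) i = r *\<^sub>R coord u i"
  by (simp add: scaleR_poly_mapping.rep_eq)

instance
proof
  fix r :: real and x y z :: "'a \<Rightarrow>\<^sub>0 'b"
  show "dist x y = norm (x - y)"
    by (fact dist_poly_mapping_def)
  show "sgn x = x /\<^sub>R norm x"
    by (fact sgn_poly_mapping_def)
  show "uniformity = (INF e\<in>{0 <..}. principal {(x :: 'a \<Rightarrow>\<^sub>0 'b, y). dist x y < e})"
    by (fact uniformity_poly_mapping_def)
  show "open U = (\<forall>x\<in>U. \<forall>\<^sub>F (x', y) in uniformity. x' = x \<longrightarrow> y \<in> U)"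
    for U :: "('a \<Rightarrow>\<^sub>0 'b) set"
    by (fact open_poly_mapping_def)
  show "norm x = sqrt (x \<bullet> x)"
    by (fact norm_poly_mapping_def)
  define A where "A = supp x \<union> supp y \<union> supp z"
  have "finite A" "supp x \<subseteq> A" "supp y \<subseteq> A" "supp (x + y) \<subseteq> A" "supp (r *\<^sub>R x) \<subseteq> A"
    using keys_add[of x y] by (auto simp: A_def in_keys_iff lookup_scaleR_poly_mapping)
  note inner_A = inner_poly_mapping_superset[OF this(1) this(2)]
    inner_poly_mapping_superset[OF this(1) this(3)]
    inner_poly_mapping_superset[OF this(1) this(4)]
    inner_poly_mapping_superset[OF this(1) this(5)]
  show "x \<bullet> y = y \<bullet> x"
    by (simp add: inner_A inner_commute)
  show "(x + y) \<bullet> z = x \<bullet> z + y \<bullet> z"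
    by (simp add: inner_A lookup_add inner_add_left sum.distrib)
  show "(r *\<^sub>R x) \<bullet> y = r * (x \<bullet> y)"
    by (simp add: inner_A lookup_scaleR_poly_mapping sum_distrib_left)
  show "0 \<le> x \<bullet> x"
    by (simp add: inner_poly_mapping_def sum_nonneg)
  show "x \<bullet> x = 0 \<longleftrightarrow> x = 0"
    by (simp add: inner_poly_mapping_def sum_nonneg_eq_0_iff) (auto simp: in_keys_iff intro: poly_mapping_eqI)
qed

end

type_synonym rvec = "nat \<Rightarrow>\<^sub>0 real"

definition Rn :: "nat \<Rightarrow> rvec set" where
  "Rn d = {v. supp v \<subseteq> {..<d}}"

text \<open>
  The library constant \<open>closest_point\<close> requires a Heine-Borel type; this is its definition
  without that class constraint.
\<close>

definition proj :: "'a::metric_space set \<Rightarrow> 'a \<Rightarrow> 'a" where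
  "proj C u = (SOME p. p \<in> C \<and> (\<forall>z\<in>C. dist u p \<le> dist u z))"

text \<open>The gradient relative to a linear subspace \<open>S\<close> of the type; it is unique if it exists.\<close>

definition gradient_in :: "'a::real_inner set \<Rightarrow> ('a \<Rightarrow> real) \<Rightarrow> 'a \<Rightarrow> 'a" where
  "gradient_in S F x = (THE g. g \<in> S \<and> (F has_derivative (\<lambda>h. g \<bullet> h)) (at x within S))"


section \<open>The function class\<close>

text \<open>
  The field \<open>grad\<close> is the gradient of the objective on \<open>domX \<times> domY\<close>. It is determined by the
  objective when the domain has nonempty interior in \<open>Rn dimx \<times> Rn dimy\<close>; otherwise the class admits any
  Lipschitz gradient field (equivalently, the gradient of any continuously differentiable
  extension with Lipschitz gradient on the domain).
\<close>

record problem =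
  dimx :: nat
  dimy :: nat
  domX :: "rvec set"
  domY :: "rvec set"
  obj :: "rvec \<times> rvec \<Rightarrow> real"
  grad :: "rvec \<times> rvec \<Rightarrow> rvec \<times> rvec"

abbreviation domXY :: "problem \<Rightarrow> (rvec \<times> rvec) set" where
  "domXY P \<equiv> domX P \<times> domY P"

text \<open>
  The conjuncts \<open>bounded\<close> and \<open>bdd_below\<close> are needed because the library's \<open>diameter\<close> and real
  infimum are unspecified when the values they stand for are infinite.
\<close>

definition NCC_pd :: "real \<Rightarrow> real \<Rightarrow> real \<Rightarrow> problem \<Rightarrow> bool" where
  "NCC_pd L G0 DY P \<longleftrightarrow>
     domX P \<subseteq> Rn (dimx P) \<and> closed (domX P) \<and> convex (domX P) \<and> 0 \<in> domX P \<and>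
     domY P \<subseteq> Rn (dimy P) \<and> closed (domY P) \<and> convex (domY P) \<and> 0 \<in> domY P \<and>
     (\<forall>z\<in>domXY P. grad P z \<in> Rn (dimx P) \<times> Rn (dimy P) \<and>
        (obj P has_derivative (\<lambda>h. grad P z \<bullet> h)) (at z within domXY P)) \<and>
     continuous_on (domXY P) (grad P) \<and>
     L-lipschitz_on (domXY P) (grad P) \<and>
     (\<forall>x\<in>domX P. concave_on (domY P) (\<lambda>y. obj P (x, y))) \<and>
     bounded (domY P) \<and> diameter (domY P) \<le> DY \<and>
     bdd_below ((\<lambda>x. obj P (x, 0)) ` domX P) \<and>
     (SUP y\<in>domY P. obj P (0, y)) - (INF x\<in>domX P. obj P (x, 0)) \<le> G0"


section \<open>Stationarity\<close>

definition Phi :: "problem \<Rightarrow> rvec \<Rightarrow> real" where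
  "Phi P x = (SUP y\<in>domY P. obj P (x, y))"

definition convex_indicator :: "'a set \<Rightarrow> 'a \<Rightarrow> ereal" where
  "convex_indicator C x = (if x \<in> C then 0 else \<infinity>)"

definition phi :: "problem \<Rightarrow> rvec \<Rightarrow> ereal" where
  "phi P x = ereal (Phi P x) + convex_indicator (domX P) x"

definition moreau_envelope :: "nat \<Rightarrow> (rvec \<Rightarrow> ereal) \<Rightarrow> real \<Rightarrow> rvec \<Rightarrow> ereal" where
  "moreau_envelope d F l x = (INF p\<in>Rn d. F p + ereal (1 / (2 * l) * (norm (p - x))\<^sup>2))"

definition stationarity_measure :: "real \<Rightarrow> problem \<Rightarrow> rvec \<Rightarrow> real" where
  "stationarity_measure L P x =
     norm (gradient_in (Rn (dimx P))
       (\<lambda>x'. real_of_ereal (moreau_envelope (dimx P) (phi P) (1 / (2 * L)) x')) x)"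


section \<open>Stochastic oracles\<close>

text \<open>
  An oracle consists of the law of the seed, a Borel probability measure on the reals, and an
  estimator mapping a query and a seed to the gradient estimate. The expectation of the estimate
  is taken coordinatewise since \<^typ>\<open>rvec\<close> is not complete.
\<close>

record oracle_model =
  seed_law :: "real measure"
  estimate :: "rvec \<times> rvec \<Rightarrow> real \<Rightarrow> rvec \<times> rvec"

definition unbiased_oracle :: "problem \<Rightarrow> real \<Rightarrow> oracle_model \<Rightarrow> bool" where
  "unbiased_oracle P mse Q \<longleftrightarrow>
     prob_space (seed_law Q) \<and> sets (seed_law Q) = sets borel \<and>
     (\<lambda>(z, s). estimate Q z s)
        \<in> borel_measurable (restrict_space borel (domXY P) \<Otimes>\<^sub>M seed_law Q) \<and>
     (\<forall>z\<in>domXY P.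
        (\<forall>s. estimate Q z s \<in> Rn (dimx P) \<times> Rn (dimy P)) \<and>
        (\<forall>i. has_bochner_integral (seed_law Q)
               (\<lambda>s. coord (fst (estimate Q z s)) i)
               (coord (fst (grad P z)) i)) \<and>
        (\<forall>i. has_bochner_integral (seed_law Q)
               (\<lambda>s. coord (snd (estimate Q z s)) i)
               (coord (snd (grad P z)) i)) \<and>
        (\<integral>\<^sup>+ s. ennreal ((norm (estimate Q z s - grad P z))\<^sup>2) \<partial>seed_law Q) \<le> ennreal mse)"


section \<open>Algorithms\<close>

text \<open>
  An algorithm may use internal randomness, a real number \<open>r\<close> with law \<open>coin_law\<close> that is
  independent of all oracle seeds; a point mass gives a deterministic algorithm. The next query
  and the primal output depend only on \<open>r\<close> and on the list of oracle responses so far.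
\<close>

type_synonym response = "real \<times> rvec \<times> rvec"

record algorithm =
  coin_law :: "real measure"
  next_query :: "real \<Rightarrow> response list \<Rightarrow> rvec \<times> rvec"
  primal_output :: "real \<Rightarrow> response list \<Rightarrow> rvec"

definition oracle_response ::
    "problem \<Rightarrow> oracle_model \<Rightarrow> rvec \<times> rvec \<Rightarrow> real \<Rightarrow> response" where
  "oracle_response P Q z s = (obj P z, estimate Q z s)"

text \<open>The responses to the first \<open>t\<close> calls, where \<open>\<xi> i\<close> is the seed of call number \<open>i\<close>.\<close>

fun transcript ::
    "problem \<Rightarrow> oracle_model \<Rightarrow> algorithm \<Rightarrow> real \<Rightarrow> (nat \<Rightarrow> real) \<Rightarrow> nat \<Rightarrow> response list" where
  "transcript P Q A r \<xi> 0 = []"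
| "transcript P Q A r \<xi> (Suc t) =
     transcript P Q A r \<xi> t @
       [oracle_response P Q (next_query A r (transcript P Q A r \<xi> t)) (\<xi> t)]"

definition iterate ::
    "problem \<Rightarrow> oracle_model \<Rightarrow> algorithm \<Rightarrow> real \<Rightarrow> (nat \<Rightarrow> real) \<Rightarrow> nat \<Rightarrow> rvec \<times> rvec" where
  "iterate P Q A r \<xi> t = next_query A r (transcript P Q A r \<xi> t)"

definition output_after ::
    "problem \<Rightarrow> oracle_model \<Rightarrow> algorithm \<Rightarrow> real \<Rightarrow> (nat \<Rightarrow> real) \<Rightarrow> nat \<Rightarrow> rvec" where
  "output_after P Q A r \<xi> q = primal_output A r (transcript P Q A r \<xi> q)"

definition revealed_x ::
    "problem \<Rightarrow> oracle_model \<Rightarrow> algorithm \<Rightarrow> real \<Rightarrow> (nat \<Rightarrow> real) \<Rightarrow> nat \<Rightarrow> nat set" where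
  "revealed_x P Q A r \<xi> t =
     (\<Union>i<t. let z = iterate P Q A r \<xi> i in supp (fst z) \<union> supp (fst (estimate Q z (\<xi> i))))"

definition revealed_y ::
    "problem \<Rightarrow> oracle_model \<Rightarrow> algorithm \<Rightarrow> real \<Rightarrow> (nat \<Rightarrow> real) \<Rightarrow> nat \<Rightarrow> nat set" where
  "revealed_y P Q A r \<xi> t =
     (\<Union>i<t. let z = iterate P Q A r \<xi> i in supp (snd z) \<union> supp (snd (estimate Q z (\<xi> i))))"

definition zero_respecting :: "problem \<Rightarrow> oracle_model \<Rightarrow> algorithm \<Rightarrow> bool" where
  "zero_respecting P Q A \<longleftrightarrow>
     (\<forall>r \<xi>.
        iterate P Q A r \<xi> 0 = (0, 0) \<and>
        (\<forall>t. \<exists>u. supp u \<subseteq> revealed_x P Q A r \<xi> (Suc t) \<and>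
               fst (iterate P Q A r \<xi> (Suc t)) = proj (domX P) u) \<and>
        (\<forall>t. \<exists>v. supp v \<subseteq> revealed_y P Q A r \<xi> (Suc t) \<and>
               snd (iterate P Q A r \<xi> (Suc t)) = proj (domY P) v) \<and>
        (\<forall>q. \<exists>u. supp u \<subseteq> revealed_x P Q A r \<xi> q \<and>
               output_after P Q A r \<xi> q = proj (domX P) u))"

text \<open>
  Product measure: the seeds are i.i.d. and independent of the internal randomness, hence each
  seed is independent of the past transcript and of the current query.
\<close>

definition run_space :: "oracle_model \<Rightarrow> algorithm \<Rightarrow> (real \<times> (nat \<Rightarrow> real)) measure" where
  "run_space Q A = coin_law A \<Otimes>\<^sub>M (\<Pi>\<^sub>M t\<in>(UNIV :: nat set). seed_law Q)"

definition zero_respecting_algorithm :: "problem \<Rightarrow> oracle_model \<Rightarrow> algorithm \<Rightarrow> bool" where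
  "zero_respecting_algorithm P Q A \<longleftrightarrow>
     prob_space (coin_law A) \<and> sets (coin_law A) = sets borel \<and>
     (\<forall>t. (\<lambda>(r, \<xi>). iterate P Q A r \<xi> t) \<in> borel_measurable (run_space Q A)) \<and>
     (\<forall>q. (\<lambda>(r, \<xi>). output_after P Q A r \<xi> q) \<in> borel_measurable (run_space Q A)) \<and>
     zero_respecting P Q A"

definition expected_stationary ::
    "real \<Rightarrow> problem \<Rightarrow> oracle_model \<Rightarrow> algorithm \<Rightarrow> real \<Rightarrow> nat \<Rightarrow> bool" where
  "expected_stationary L P Q A \<epsilon> q \<longleftrightarrow>
     (\<integral>\<^sup>+ (r, \<xi>). ennreal (stationarity_measure L P (output_after P Q A r \<xi> q)) \<partial>run_space Q A)
       \<le> ennreal \<epsilon>"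

end

theory Submission
  imports Defs
begin

text \<open>
  The instance is a chain of \<open>T\<close> links. Link \<open>k\<close> connects two consecutive primal coordinates
  \<open>a = x\<^sub>k\<^sub>-\<^sub>1\<close> and \<open>b = x\<^sub>k\<close> through \<open>n + 1\<close> dual coordinates joined by \<open>n\<close> springs: \<open>a\<close> pulls at the
  first of them, \<open>b\<close> is coupled to the last one, so dual information has to cross the whole
  link before \<open>b\<close> receives a gradient. Maximising over the dual variable gives
  \<open>((a\<^sup>2 - b\<^sup>2)\<^sup>2 + a\<^sup>2 (a - b)\<^sup>2) / (2 s\<^sup>2) - 5 b\<^sup>2 / 2\<close> per link, up to the factor \<open>\<kappa>\<close>. On the cone
  \<open>s \<ge> x\<^sub>0 \<ge> x\<^sub>1 \<ge> \<dots> \<ge> 0\<close> the forces \<open>a\<^sup>2 - b\<^sup>2\<close> telescope, which keeps the maximiser inside a ball of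
  radius \<open>O(n s)\<close> for every \<open>T\<close>, and at the first coordinate below \<open>s\<close> the slope of the primal
  function is at most \<open>- \<kappa> s\<close>. Hence the Moreau gradient is at least \<open>\<kappa> s\<close> until the last
  link has been crossed.

  The springs are Huber functions, so the gradient in a dual coordinate that is about to be
  revealed is at most \<open>\<kappa> s / \<surd>n\<close>, although the dual variable itself is as large as \<open>\<surd>n s\<close>. The oracle
  multiplies this one coordinate by a Bernoulli variable of parameter
  \<open>p = min 1 (\<kappa>\<^sup>2 s\<^sup>2 / (n \<sigma>\<^sup>2))\<close> divided by \<open>p\<close>, so that crossing all links takes about
  \<open>T n / p\<close> calls. The bound follows with \<open>\<kappa> = L / 64\<close>, \<open>\<kappa> s = 2 \<epsilon>\<close>, \<open>n \<approx> L D / \<epsilon>\<close> and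
  \<open>T \<approx> L G\<^sub>0 / \<epsilon>\<^sup>2\<close>, up to constants.
\<close>


text \<open>Dividing the remainder by \<open>norm (y - x)\<close> leaves at most
  \<open>C * norm (y - x)\<close>. The Moreau envelope and the Huber function are both
  differentiated through such a two-sided bound.\<close>

lemma quadratic_remainder_has_derivative:
  fixes F :: "'a::real_inner \<Rightarrow> real"
  assumes "\<And>y. y \<in> S \<Longrightarrow> \<bar>F y - F x - g \<bullet> (y - x)\<bar> \<le> C * (norm (y - x))\<^sup>2"
  shows "(F has_derivative (\<lambda>h. g \<bullet> h)) (at x within S)"
proof -
  have "((\<lambda>y. (F y - F x - g \<bullet> (y - x)) /\<^sub>R norm (y - x)) \<longlongrightarrow> 0) (at x within S)"
  proof (rule Lim_null_comparison)
    show "\<forall>\<^sub>F y in at x within S.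
        norm ((F y - F x - g \<bullet> (y - x)) /\<^sub>R norm (y - x)) \<le> C * norm (y - x)"
      unfolding eventually_at_filter
    proof (intro always_eventually allI impI)
      fix y assume "y \<noteq> x" "y \<in> S"
      then show "norm ((F y - F x - g \<bullet> (y - x)) /\<^sub>R norm (y - x)) \<le> C * norm (y - x)"
        using assms[of y] by (simp add: divide_simps power2_eq_square mult.assoc)
    qed
    have "((\<lambda>y. C * norm (y - x)) \<longlongrightarrow> C * norm (x - x)) (at x within S)"
      by (intro tendsto_intros)
    then show "((\<lambda>y. C * norm (y - x)) \<longlongrightarrow> 0) (at x within S)" by simp
  qed
  then show ?thesis
    by (simp add: has_derivative_within bounded_linear_inner_right diff_diff_eq divide_inverse mult.commute)
qed

section \<open>Moreau envelopes of weakly convex functions\<close>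

text \<open>The proximal point for the parameter \<open>1 / (2 * L)\<close>, whose penalty factor is
  \<open>L\<close>.\<close>

definition is_prox :: "'a::real_inner set \<Rightarrow> ('a \<Rightarrow> real) \<Rightarrow> real \<Rightarrow> 'a \<Rightarrow> 'a \<Rightarrow> bool" where
  "is_prox X F L x p \<longleftrightarrow>
     p \<in> X \<and> (\<forall>v\<in>X. F p + L * (norm (p - x))\<^sup>2 \<le> F v + L * (norm (v - x))\<^sup>2)"

text \<open>The last assumption expresses convexity of \<open>F + L / 2 * (norm u)^2\<close> on
  \<open>X\<close> without derivatives. Compactness of \<open>X\<close> supplies minimisers, since
  the ambient inner product space may be incomplete.\<close>

locale weakly_convex =
  fixes X :: "'a::real_inner set" and F :: "'a \<Rightarrow> real" and L :: real
  assumes L_pos: "L > 0"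
    and compact_X: "compact X" and convex_X: "convex X" and X_ne: "X \<noteq> {}"
    and cont: "continuous_on X F"
    and weak_convexity: "\<And>u v t. u \<in> X \<Longrightarrow> v \<in> X \<Longrightarrow> 0 \<le> t \<Longrightarrow> t \<le> 1 \<Longrightarrow>
      F ((1 - t) *\<^sub>R u + t *\<^sub>R v)
        \<le> (1 - t) * F u + t * F v + L / 2 * t * (1 - t) * (norm (u - v))\<^sup>2"
begin

lemma prox_exists: "\<exists>p. is_prox X F L x p"
proof -
  have "continuous_on X (\<lambda>v. F v + L * (norm (v - x))\<^sup>2)"
    by (intro continuous_intros cont)
  from continuous_attains_inf[OF compact_X X_ne this] show ?thesis
    by (auto simp: is_prox_def)
qed

text \<open>The proximal objective adds a \<open>2 * L\<close>-strongly convex penalty to an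
  \<open>L\<close>-weakly convex function, so it is \<open>L\<close>-strongly convex and grows
  quadratically away from its minimiser.\<close>

lemma prox_growth:
  assumes p: "is_prox X F L x p" and v: "v \<in> X"
  shows "F p + L * (norm (p - x))\<^sup>2 + L / 2 * (norm (v - p))\<^sup>2 \<le> F v + L * (norm (v - x))\<^sup>2"
proof -
  define J where "J u = F u + L * (norm (u - x))\<^sup>2" for u
  have pX: "p \<in> X" using p by (simp add: is_prox_def)
  \<comment> \<open>Minimality of \<open>p\<close> is tested along the segment towards
    \<open>v\<close>; after division by \<open>t\<close>, letting \<open>t\<close> tend to 0 gives
    the full constant.\<close>
  have *: "J p \<le> J v - L / 2 * (1 - t) * (norm (v - p))\<^sup>2" if t: "0 < t" "t \<le> 1" for t
  proof -
    define u where "u = (1 - t) *\<^sub>R p + t *\<^sub>R v"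
    have uX: "u \<in> X" unfolding u_def
      using convexD[OF convex_X pX v, of "1 - t" t] t by simp
    have sq: "(norm (u - x))\<^sup>2 =
        (1 - t) * (norm (p - x))\<^sup>2 + t * (norm (v - x))\<^sup>2 - t * (1 - t) * (norm (p - v))\<^sup>2"
      unfolding u_def power2_norm_eq_inner
      by (simp add: inner_diff_left inner_diff_right inner_add_left inner_add_right
          inner_commute algebra_simps power2_eq_square)
    have "J p \<le> J u" using p uX by (simp add: is_prox_def J_def)
    also have "\<dots> \<le> (1 - t) * F p + t * F v + L / 2 * t * (1 - t) * (norm (p - v))\<^sup>2
        + L * (norm (u - x))\<^sup>2"
      using weak_convexity[OF pX v, of t] t by (simp add: J_def u_def)
    also have "\<dots> = (1 - t) * J p + t * J v - t * (L / 2 * (1 - t) * (norm (v - p))\<^sup>2)"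
      unfolding J_def sq norm_minus_commute[of v p] by (simp add: algebra_simps)
    finally have "t * J p \<le> t * (J v - L / 2 * (1 - t) * (norm (v - p))\<^sup>2)"
      by (simp add: algebra_simps)
    then show ?thesis using t by simp
  qed
  have "J p \<le> J v - L / 2 * (1 - 0) * (norm (v - p))\<^sup>2"
  proof (rule tendsto_lowerbound)
    show "((\<lambda>t. J v - L / 2 * (1 - t) * (norm (v - p))\<^sup>2) \<longlongrightarrow>
        J v - L / 2 * (1 - 0) * (norm (v - p))\<^sup>2) (at_right 0)"
      by (intro tendsto_intros)
    show "\<forall>\<^sub>F t in at_right 0. J p \<le> J v - L / 2 * (1 - t) * (norm (v - p))\<^sup>2"
      unfolding eventually_at_right_field using * by (intro exI[of _ 1]) auto
  qed simp
  then show ?thesis by (simp add: J_def)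
qed

text \<open>Adding the growth inequalities of the two proximal points cancels \<open>F\<close> and
  leaves a quadratic expression equal to \<open>2 * ((p - q) \<bullet> (x - x'))\<close>. With
  \<open>x = x'\<close> this is uniqueness.\<close>

lemma prox_Lipschitz:
  assumes p: "is_prox X F L x p" and q: "is_prox X F L x' q"
  shows "norm (p - q) \<le> 2 * norm (x - x')"
proof -
  have "L * (norm (p - q))\<^sup>2 \<le> L * ((norm (q - x))\<^sup>2 - (norm (q - x'))\<^sup>2 + (norm (p - x'))\<^sup>2
      - (norm (p - x))\<^sup>2)"
    using prox_growth[OF p, of q] prox_growth[OF q, of p] p q
    by (simp add: is_prox_def algebra_simps norm_minus_commute)
  then have "(norm (p - q))\<^sup>2 \<le> (norm (q - x))\<^sup>2 - (norm (q - x'))\<^sup>2 + (norm (p - x'))\<^sup>2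
      - (norm (p - x))\<^sup>2"
    using L_pos by simp
  also have "\<dots> = 2 * ((p - q) \<bullet> (x - x'))"
    unfolding power2_norm_eq_inner
    by (simp add: inner_diff_left inner_diff_right inner_commute algebra_simps)
  also have "\<dots> \<le> 2 * (norm (p - q) * norm (x - x'))"
    using norm_cauchy_schwarz[of "p - q" "x - x'"] by simp
  finally have "norm (p - q) * norm (p - q) \<le> norm (p - q) * (2 * norm (x - x'))"
    by (simp add: power2_eq_square algebra_simps)
  then show ?thesis
    by (cases "norm (p - q) = 0") (auto simp: mult_le_cancel_left)
qed

text \<open>Testing the old minimiser at the new point bounds the envelope from above, testing the
  new minimiser at the old point bounds it from below. The two bounds differ by a quadratic amount
  because the proximal map is Lipschitz.\<close>

lemma envelope_has_derivative:
  assumes M: "\<And>x. \<exists>p. is_prox X F L x p \<and> M x = F p + L * (norm (p - x))\<^sup>2"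
    and p: "is_prox X F L x p"
  shows "(M has_derivative (\<lambda>h. (2 * L) *\<^sub>R (x - p) \<bullet> h)) (at x within S)"
proof (rule quadratic_remainder_has_derivative)
  fix x'
  obtain p0 where p0: "is_prox X F L x p0" "M x = F p0 + L * (norm (p0 - x))\<^sup>2" using M by blast
  have Mx: "M x = F p + L * (norm (p - x))\<^sup>2"
    using p p0 unfolding is_prox_def by force
  obtain q where q: "is_prox X F L x' q" "M x' = F q + L * (norm (q - x'))\<^sup>2" using M by blast
  define h where "h = x' - x"
  have expand: "(norm (u - x'))\<^sup>2 = (norm (u - x))\<^sup>2 + 2 * ((x - u) \<bullet> h) + (norm h)\<^sup>2" for u
    unfolding power2_norm_eq_inner h_def
    by (simp add: inner_diff_left inner_diff_right inner_commute algebra_simps)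
  have "M x' \<le> F p + L * (norm (p - x'))\<^sup>2"
    using q p by (simp add: is_prox_def)
  then have up: "M x' - M x - 2 * L * ((x - p) \<bullet> h) \<le> L * (norm h)\<^sup>2"
    unfolding expand Mx by (simp add: algebra_simps)
  have "M x \<le> F q + L * (norm (q - x))\<^sup>2"
    using q p by (simp add: is_prox_def Mx)
  then have "M x' - M x \<ge> L * (2 * ((x - q) \<bullet> h) + (norm h)\<^sup>2)"
    unfolding q(2) expand by (simp add: algebra_simps)
  moreover have "(x - q) \<bullet> h = (x - p) \<bullet> h + (p - q) \<bullet> h"
    by (simp add: inner_diff_left)
  moreover have "\<bar>(p - q) \<bullet> h\<bar> \<le> 2 * (norm h)\<^sup>2"
  proof -
    have "\<bar>(p - q) \<bullet> h\<bar> \<le> norm (p - q) * norm h" by (rule Cauchy_Schwarz_ineq2)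
    also have "\<dots> \<le> (2 * norm h) * norm h"
      using prox_Lipschitz[OF p q(1)] by (intro mult_right_mono) (auto simp: h_def norm_minus_commute)
    finally show ?thesis by (simp add: power2_eq_square)
  qed
  ultimately have "M x' - M x - 2 * L * ((x - p) \<bullet> h) \<ge> L * (2 * ((p - q) \<bullet> h) + (norm h)\<^sup>2)"
    by (simp add: algebra_simps)
  moreover have "L * (2 * ((p - q) \<bullet> h) + (norm h)\<^sup>2) \<ge> L * (- 4 * (norm h)\<^sup>2)"
    using L_pos \<open>\<bar>(p - q) \<bullet> h\<bar> \<le> 2 * (norm h)\<^sup>2\<close>
    by (intro mult_left_mono) (auto simp: abs_le_iff)
  ultimately have "M x' - M x - 2 * L * ((x - p) \<bullet> h) \<ge> - (4 * L * (norm h)\<^sup>2)" by simp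
  moreover have "L * (norm h)\<^sup>2 \<le> 4 * L * (norm h)\<^sup>2" using L_pos by (simp add: mult_right_mono)
  ultimately show "\<bar>M x' - M x - (2 * L) *\<^sub>R (x - p) \<bullet> (x' - x)\<bar> \<le> 4 * L * (norm (x' - x))\<^sup>2"
    using up by (simp add: h_def[symmetric] abs_le_iff)
qed

end

text \<open>Uniqueness is checked along the line through \<open>x\<close> in direction
  \<open>g - g'\<close>, which stays in \<open>S\<close>: both candidates give the derivative there,
  so \<open>g - g'\<close> is orthogonal to itself.\<close>

lemma gradient_in_eqI:
  fixes F :: "'a::real_inner \<Rightarrow> real"
  assumes S: "subspace S" and x: "x \<in> S" and g: "g \<in> S"
    and D: "(F has_derivative (\<lambda>h. g \<bullet> h)) (at x within S)"
  shows "gradient_in S F x = g"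
  unfolding gradient_in_def
proof (rule the_equality)
  fix g' assume g': "g' \<in> S \<and> (F has_derivative (\<lambda>h. g' \<bullet> h)) (at x within S)"
  define v where "v = g - g'"
  have vS: "v \<in> S" using g g' S by (simp add: v_def subspace_diff)
  have line: "((\<lambda>t. F (x + t *\<^sub>R v)) has_derivative (\<lambda>t. u \<bullet> (t *\<^sub>R v))) (at 0)"
    if "(F has_derivative (\<lambda>h. u \<bullet> h)) (at x within S)" for u
  proof -
    have "((\<lambda>t. x + t *\<^sub>R v) has_derivative (\<lambda>t. t *\<^sub>R v)) (at 0)"
      by (auto intro!: derivative_eq_intros)
    moreover have "range (\<lambda>t. x + t *\<^sub>R v) \<subseteq> S"
      using x vS S by (auto intro: subspace_add subspace_scale)
    then have "(F has_derivative (\<lambda>h. u \<bullet> h)) (at (x + 0 *\<^sub>R v) within range (\<lambda>t. x + t *\<^sub>R v))"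
      using that by (auto intro: has_derivative_subset)
    ultimately show ?thesis
      using has_derivative_in_compose[of "\<lambda>t. x + t *\<^sub>R v" "\<lambda>t. t *\<^sub>R v" 0 UNIV F "\<lambda>h. u \<bullet> h"]
      by simp
  qed
  have "(\<lambda>t. g \<bullet> (t *\<^sub>R v)) = (\<lambda>t. g' \<bullet> (t *\<^sub>R v))"
    using line[OF D] line[of g'] g' has_derivative_unique by blast
  then have "g \<bullet> v = g' \<bullet> v" by (auto dest: fun_cong[of _ _ 1])
  then have "v \<bullet> v = 0" by (simp add: v_def inner_diff_left)
  then show "g' = g" by (simp add: v_def)
qed (use g D in simp)

section \<open>Finitely supported real sequences\<close>

text \<open>Applied to \<open>coord v\<close> this truncates \<open>v\<close> to its first
  \<open>d\<close> coordinates.\<close>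

definition rvec_of :: "nat \<Rightarrow> (nat \<Rightarrow> real) \<Rightarrow> rvec" where
  "rvec_of d g = (\<Sum>i<d. Poly_Mapping.single i (g i))"

lemma coord_rvec_of: "coord (rvec_of d g) i = (if i < d then g i else 0)"
  by (simp add: rvec_of_def lookup_sum lookup_single when_def)

lemma rvec_of_in_Rn: "rvec_of d g \<in> Rn d"
  by (auto simp: Rn_def in_keys_iff coord_rvec_of split: if_splits)

lemma Rn_iff: "v \<in> Rn d \<longleftrightarrow> (\<forall>i\<ge>d. coord v i = 0)"
  by (auto simp: Rn_def in_keys_iff subset_iff) (meson not_le)

lemma inner_Rn: "u \<in> Rn d \<Longrightarrow> u \<bullet> v = (\<Sum>i<d. coord u i * coord v i)"
  by (subst inner_poly_mapping_superset[of "{..<d}"]) (auto simp: Rn_def)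

lemma inner_rvec_of: "rvec_of d g \<bullet> v = (\<Sum>i<d. g i * coord v i)"
  by (simp add: inner_Rn[OF rvec_of_in_Rn] coord_rvec_of)

lemma coord_eq_inner: "coord v i = Poly_Mapping.single i 1 \<bullet> v"
  by (subst inner_poly_mapping_superset[of "{i}"]) auto

lemma bounded_linear_coord: "bounded_linear (\<lambda>v :: rvec. coord v i)"
  unfolding coord_eq_inner by (rule bounded_linear_inner_right)

lemmas coord_has_derivative [derivative_intros] =
  bounded_linear.has_derivative[OF bounded_linear_coord]

lemmas continuous_on_coord [continuous_intros] =
  bounded_linear.continuous_on[OF bounded_linear_coord]

lemmas coord_simps = lookup_add lookup_minus lookup_uminus lookup_scaleR_poly_mapping

lemma norm_Rn: "v \<in> Rn d \<Longrightarrow> norm v = L2_set (coord v) {..<d}"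
  by (simp add: norm_eq_sqrt_inner inner_Rn L2_set_def power2_eq_square)

lemma norm2_Rn: "v \<in> Rn d \<Longrightarrow> (norm v)\<^sup>2 = (\<Sum>i<d. (coord v i)\<^sup>2)"
  by (simp add: norm_Rn L2_set_def sum_nonneg)

lemma rrvec_of_in_Rn: "\<exists>d\<ge>d0. v \<in> Rn d"
proof -
  obtain e where "supp v \<subseteq> {..<e}"
    by (meson finite_keys finite_nat_iff_bounded)
  then have "v \<in> Rn (max d0 e)" by (force simp: Rn_def)
  then show ?thesis by (meson max.cobounded1)
qed

lemma abs_coord_le_norm: "\<bar>coord v i\<bar> \<le> norm (v :: rvec)"
  using Cauchy_Schwarz_ineq2[of "Poly_Mapping.single i 1" v]
  by (simp add: coord_eq_inner[symmetric] norm_eq_sqrt_inner[of "Poly_Mapping.single i 1"])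

lemma subspace_Rn: "subspace (Rn d)"
  by (auto simp: subspace_def Rn_iff coord_simps)

lemma Rn_mono: "d \<le> d' \<Longrightarrow> Rn d \<subseteq> Rn d'"
  by (auto simp: Rn_iff)

lemma closed_Rn: "closed (Rn d)"
proof -
  have "Rn d = {v. \<forall>i. i \<ge> d \<longrightarrow> coord v i = 0}" by (auto simp: Rn_iff)
  moreover have "closed \<dots>"
    by (intro closed_Collect_all closed_Collect_imp closed_Collect_eq continuous_intros) simp_all
  ultimately show ?thesis by simp
qed

text \<open>Closed balls of the whole sequence space are not compact, so compactness is built
  dimension by dimension: the box in dimension \<open>Suc d\<close> is a continuous image of the box
  in dimension \<open>d\<close> times an interval.\<close>

lemma compact_box: "compact {v \<in> Rn d. \<forall>i. \<bar>coord v i\<bar> \<le> c}" (is "compact (?K d)")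
proof (cases "c \<ge> 0")
  case c: True
  show ?thesis
  proof (induction d)
    case 0
    have "?K 0 = {0}" using c by (auto simp: Rn_iff intro: poly_mapping_eqI)
    then show ?case by simp
  next
    case (Suc d)
    let ?F = "\<lambda>(v, t). v + t *\<^sub>R Poly_Mapping.single d (1::real)"
    have "v \<in> ?F ` (?K d \<times> {-c..c})" if v: "v \<in> ?K (Suc d)" for v
    proof
      show "v = ?F (rvec_of d (coord v), coord v d)"
        using v by (intro poly_mapping_eqI)
          (auto simp: coord_simps coord_rvec_of lookup_single when_def Rn_iff)
      show "(rvec_of d (coord v), coord v d) \<in> ?K d \<times> {-c..c}"
        using v c by (auto simp: rvec_of_in_Rn coord_rvec_of abs_le_iff minus_le_iff)
    qed
    moreover have "?F z \<in> ?K (Suc d)" if "z \<in> ?K d \<times> {-c..c}" for z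
      using that c by (auto simp: Rn_iff coord_simps lookup_single when_def abs_le_iff)
    ultimately have "?K (Suc d) = ?F ` (?K d \<times> {-c..c})" by blast
    moreover have "compact (?F ` (?K d \<times> {-c..c}))"
      by (intro compact_continuous_image compact_Times Suc)
        (auto simp: case_prod_unfold intro!: continuous_intros)
    ultimately show ?case by simp
  qed
next
  case False
  then have "\<not> \<bar>coord v 0\<bar> \<le> c" for v :: rvec by linarith
  then have "?K d = {}" by blast
  then show ?thesis by (simp only: compact_empty)
qed

lemma proj_closest:
  fixes C :: "rvec set"
  assumes "compact C" "C \<noteq> {}"
  shows "proj C u \<in> C" and "z \<in> C \<Longrightarrow> dist u (proj C u) \<le> dist u z"
proof -
  have "\<exists>p. p \<in> C \<and> (\<forall>z\<in>C. dist u p \<le> dist u z)"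
    using continuous_attains_inf[OF assms, of "dist u"]
      continuous_on_dist[OF continuous_on_const continuous_on_id, of C u] by auto
  from someI_ex[OF this] show "proj C u \<in> C" "z \<in> C \<Longrightarrow> dist u (proj C u) \<le> dist u z"
    by (auto simp: proj_def)
qed

text \<open>Zero-respecting steps are projected, so projection must not create new coordinates.
  Since \<open>u\<close> vanishes from \<open>j\<close> on, truncating the projection there cannot
  increase its distance to \<open>u\<close>, and would decrease it strictly if anything nonzero were
  removed.\<close>

lemma supp_proj:
  assumes C: "compact C" "C \<noteq> {}"
    and trunc: "\<And>v. v \<in> C \<Longrightarrow> rvec_of j (coord v) \<in> C"
    and u: "supp u \<subseteq> {..<j}"
  shows "supp (proj C u) \<subseteq> {..<j}"
proof -
  define p where "p = proj C u"
  obtain d where d: "d \<ge> j" "u - p \<in> Rn d" using rrvec_of_in_Rn by blast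
  define p' where "p' = rvec_of j (coord p)"
  have u0: "coord u i = 0" if "\<not> i < j" for i using u that by (auto simp: in_keys_iff)
  have d': "u - p' \<in> Rn d"
    using d(1) by (auto simp: Rn_iff coord_simps p'_def coord_rvec_of u0)
  have "dist u p \<le> dist u p'"
    unfolding p_def using C trunc proj_closest p'_def p_def by blast
  then have "(norm (u - p))\<^sup>2 \<le> (norm (u - p'))\<^sup>2" by (simp add: dist_norm)
  then have le: "(\<Sum>i<d. (coord (u - p) i)\<^sup>2) \<le> (\<Sum>i<d. (coord (u - p') i)\<^sup>2)"
    by (simp add: norm2_Rn[OF d(2)] norm2_Rn[OF d'])
  have mono: "(coord (u - p') i)\<^sup>2 \<le> (coord (u - p) i)\<^sup>2" for i
    by (auto simp: coord_simps p'_def coord_rvec_of u0)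
  have eq: "(coord (u - p') i)\<^sup>2 = (coord (u - p) i)\<^sup>2" if "i < d" for i
  proof (rule ccontr)
    assume "(coord (u - p') i)\<^sup>2 \<noteq> (coord (u - p) i)\<^sup>2"
    then have "(coord (u - p') i)\<^sup>2 < (coord (u - p) i)\<^sup>2" using mono[of i] by simp
    then have "(\<Sum>i<d. (coord (u - p') i)\<^sup>2) < (\<Sum>i<d. (coord (u - p) i)\<^sup>2)"
      by (intro sum_strict_mono_ex1) (use that mono in auto)
    with le show False by simp
  qed
  have "coord p i = 0" if "i \<ge> j" for i
  proof (cases "i < d")
    case True
    with eq[OF True] that show ?thesis by (simp add: coord_simps p'_def coord_rvec_of u0)
  next
    case False
    with d that show ?thesis by (simp add: Rn_iff coord_simps u0)
  qed
  then show ?thesis by (auto simp: in_keys_iff p_def[symmetric]) (meson not_le)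
qed

section \<open>The Huber function\<close>

text \<open>Projection onto the interval from \<open>- \<delta>\<close> to \<open>\<delta>\<close>;
  it is the derivative of \<open>huber\<close>.\<close>

definition clip :: "real \<Rightarrow> real \<Rightarrow> real" where
  "clip \<delta> d = max (- \<delta>) (min \<delta> d)"

text \<open>Half the square up to \<open>\<delta>\<close>, affine with slope of modulus
  \<open>\<delta>\<close> beyond; subtracting the squared excess covers both in one formula.\<close>

definition huber :: "real \<Rightarrow> real \<Rightarrow> real" where
  "huber \<delta> d = d\<^sup>2 / 2 - (max 0 (\<bar>d\<bar> - \<delta>))\<^sup>2 / 2"

lemma abs_clip: "\<delta> \<ge> 0 \<Longrightarrow> \<bar>clip \<delta> d\<bar> \<le> \<delta>"
  by (auto simp: clip_def)

lemma clip_0: "\<delta> \<ge> 0 \<Longrightarrow> clip \<delta> 0 = 0"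
  by (auto simp: clip_def)

lemma clip_Lipschitz: "\<bar>clip \<delta> d - clip \<delta> e\<bar> \<le> \<bar>d - e\<bar>"
  by (auto simp: clip_def max_def min_def)

lemma huber_cases:
  assumes "\<delta> \<ge> 0"
  obtains (mid) "\<bar>d\<bar> \<le> \<delta>" "huber \<delta> d = d\<^sup>2 / 2" "clip \<delta> d = d"
  | (up) "d > \<delta>" "huber \<delta> d = \<delta> * d - \<delta>\<^sup>2 / 2" "clip \<delta> d = \<delta>"
  | (down) "d < - \<delta>" "huber \<delta> d = - \<delta> * d - \<delta>\<^sup>2 / 2" "clip \<delta> d = - \<delta>"
proof -
  consider "\<bar>d\<bar> \<le> \<delta>" | "d > \<delta>" | "d < - \<delta>" by linarith
  then show ?thesis
  proof cases
    case 1 then show ?thesis by (intro mid) (auto simp: huber_def clip_def max_def min_def)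
  next
    case 2 with assms show ?thesis
      by (intro up) (auto simp: huber_def clip_def max_def min_def power2_eq_square field_simps)
  next
    case 3 with assms show ?thesis
      by (intro down) (auto simp: huber_def clip_def max_def min_def power2_eq_square field_simps)
  qed
qed

text \<open>The supporting-line form of convexity. In each combination of regimes the gap reduces to
  squares and to products of factors with known signs.\<close>

lemma huber_tangent:
  assumes "\<delta> \<ge> 0"
  shows "huber \<delta> d + clip \<delta> d * (e - d) \<le> huber \<delta> e"
proof -
  have sq: "0 \<le> (x - y)\<^sup>2" for x y :: real by simp
  have pr: "0 \<le> (x - y) * (u - v)" if "y \<le> x" "v \<le> u" for x y u v :: real using that by simp
  show ?thesis
  proof (cases rule: huber_cases[OF assms, of d, case_names mid up down])
    case d: mid
    show ?thesis
    proof (cases rule: huber_cases[OF assms, of e, case_names mid up down])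
      case mid with d sq[of d e] show ?thesis by (simp add: power2_eq_square algebra_simps)
    next
      case up with d sq[of d \<delta>] pr[of d \<delta> \<delta> e] pr[of \<delta> d e \<delta>] show ?thesis
        by (simp add: power2_eq_square algebra_simps abs_le_iff)
    next
      case down
      have "- \<delta> \<le> d" using d by linarith
      with down d sq[of d "- \<delta>"] pr[of "-\<delta>" d e "-\<delta>"] pr[of d "-\<delta>" "-\<delta>" e] show ?thesis
        by (simp add: power2_eq_square algebra_simps abs_le_iff)
    qed
  next
    case d: up
    show ?thesis
    proof (cases rule: huber_cases[OF assms, of e, case_names mid up down])
      case mid with d sq[of e \<delta>] show ?thesis by (simp add: power2_eq_square algebra_simps)
    next
      case up with d show ?thesis by (simp add: algebra_simps)
    next
      case down with d assms mult_nonneg_nonpos[of \<delta> e] show ?thesis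
        by (simp add: algebra_simps)
    qed
  next
    case d: down
    show ?thesis
    proof (cases rule: huber_cases[OF assms, of e, case_names mid up down])
      case mid with d sq[of e "-\<delta>"] show ?thesis by (simp add: power2_eq_square algebra_simps)
    next
      case up
      with assms have "0 \<le> \<delta> * e" by simp
      with up d show ?thesis by (simp add: algebra_simps)
    next
      case down with d show ?thesis by (simp add: algebra_simps)
    qed
  qed
qed

text \<open>The tangent inequality at \<open>e\<close>, read backwards, has slope
  \<open>clip \<delta> e\<close>; replacing it by \<open>clip \<delta> d\<close> costs at most
  \<open>(e - d)^2\<close> because \<open>clip\<close> is 1-Lipschitz.\<close>

lemma huber_upper:
  assumes "\<delta> \<ge> 0"
  shows "huber \<delta> e \<le> huber \<delta> d + clip \<delta> d * (e - d) + (e - d)\<^sup>2"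
proof -
  have "huber \<delta> e \<le> huber \<delta> d + clip \<delta> e * (e - d)"
    using huber_tangent[OF assms, of e d] by (simp add: algebra_simps)
  also have "\<dots> = huber \<delta> d + clip \<delta> d * (e - d) + (clip \<delta> e - clip \<delta> d) * (e - d)"
    by (simp add: algebra_simps)
  also have "(clip \<delta> e - clip \<delta> d) * (e - d) \<le> \<bar>clip \<delta> e - clip \<delta> d\<bar> * \<bar>e - d\<bar>"
    by (metis abs_ge_self abs_mult)
  also have "\<dots> \<le> \<bar>e - d\<bar> * \<bar>e - d\<bar>"
    by (intro mult_right_mono clip_Lipschitz) auto
  finally show ?thesis by (simp add: power2_eq_square)
qed

lemma huber_has_derivative [derivative_intros]:
  assumes "\<delta> \<ge> 0" "(g has_derivative g') (at x within S)"
  shows "((\<lambda>x. huber \<delta> (g x)) has_derivative (\<lambda>h. clip \<delta> (g x) * g' h)) (at x within S)"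
proof -
  have "(huber \<delta> has_derivative (\<lambda>h. clip \<delta> d \<bullet> h)) (at d)" for d
  proof (rule quadratic_remainder_has_derivative)
    fix e
    show "\<bar>huber \<delta> e - huber \<delta> d - clip \<delta> d \<bullet> (e - d)\<bar> \<le> 1 * (norm (e - d))\<^sup>2"
      using huber_tangent[OF assms(1), of d e] huber_upper[OF assms(1), of e d]
      by (simp add: abs_le_iff)
  qed
  from has_derivative_compose[OF assms(2) this] show ?thesis by simp
qed

lemma huber_convex:
  assumes "\<delta> \<ge> 0" "0 \<le> t" "t \<le> 1"
  shows "huber \<delta> ((1 - t) * u + t * v) \<le> (1 - t) * huber \<delta> u + t * huber \<delta> v"
proof -
  define w where "w = (1 - t) * u + t * v"
  have "(1 - t) * (huber \<delta> w + clip \<delta> w * (u - w)) + t * (huber \<delta> w + clip \<delta> w * (v - w))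
      \<le> (1 - t) * huber \<delta> u + t * huber \<delta> v"
    using assms by (intro add_mono mult_left_mono huber_tangent) auto
  moreover have "(1 - t) * (huber \<delta> w + clip \<delta> w * (u - w)) + t * (huber \<delta> w + clip \<delta> w * (v - w))
      = huber \<delta> w"
    by (simp add: w_def algebra_simps)
  ultimately show ?thesis by (simp add: w_def)
qed

text \<open>Fenchel-Young: the conjugate of the Huber function is \<open>r^2 / 2\<close> for forces
  up to \<open>\<delta>\<close>, with equality at \<open>d = r\<close>. A spring loaded within this
  limit acts like a plain quadratic one.\<close>

lemma huber_conjugate:
  assumes "\<bar>r\<bar> \<le> \<delta>"
  shows "r * d - huber \<delta> d \<le> r\<^sup>2 / 2" and "huber \<delta> r = r\<^sup>2 / 2"
proof -
  have \<delta>: "\<delta> \<ge> 0" using assms by linarith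
  show r: "huber \<delta> r = r\<^sup>2 / 2"
    using assms by (auto simp: huber_def)
  have "clip \<delta> r = r" using assms by (auto simp: clip_def)
  with huber_tangent[OF \<delta>, of r d] r show "r * d - huber \<delta> d \<le> r\<^sup>2 / 2"
    by (simp add: power2_eq_square algebra_simps)
qed

section \<open>Sums and norms along chains of coordinates\<close>

text \<open>Together with \<open>sum_shift_down\<close> this transposes an index shift. The
  vanishing boundary coefficient removes the term that would fall outside the range.\<close>

lemma sum_shift_up:
  fixes c u :: "nat \<Rightarrow> real"
  assumes "c (N - 1) = 0"
  shows "(\<Sum>j<N. c j * u (Suc j)) = (\<Sum>j<N. (case j of 0 \<Rightarrow> 0 | Suc i \<Rightarrow> c i) * u j)"
proof (cases N)
  case (Suc M)
  have "(\<Sum>j<Suc M. (case j of 0 \<Rightarrow> 0 | Suc i \<Rightarrow> c i) * u j) = (\<Sum>j<M. c j * u (Suc j))"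
    by (subst sum.lessThan_Suc_shift) simp
  with Suc assms show ?thesis by simp
qed simp

lemma sum_shift_down:
  fixes c u :: "nat \<Rightarrow> real"
  assumes "c N = 0"
  shows "(\<Sum>k<N. c k * (case k of 0 \<Rightarrow> 0 | Suc i \<Rightarrow> u i)) = (\<Sum>k<N. c (Suc k) * u k)"
proof (cases N)
  case (Suc M)
  have "(\<Sum>k<Suc M. c k * (case k of 0 \<Rightarrow> 0 | Suc i \<Rightarrow> u i)) = (\<Sum>k<M. c (Suc k) * u k)"
    by (subst sum.lessThan_Suc_shift) simp
  with Suc assms show ?thesis by simp
qed simp

lemma sum_blocks: "(\<Sum>j<T * m. f j) = (\<Sum>k<T. \<Sum>i<m. f (k * m + i))"
  for f :: "nat \<Rightarrow> 'a::comm_monoid_add"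
proof -
  have "sum f {k * m..<k * m + m} = (\<Sum>i<m. f (k * m + i))" for k
    using sum.shift_bounds_nat_ivl[of f 0 "k * m" m]
    by (simp add: atLeast0LessThan add.commute)
  then show ?thesis by (simp flip: sum.nat_group)
qed

lemma sum_residue_class:
  fixes f :: "nat \<Rightarrow> real"
  assumes "r < m"
  shows "(\<Sum>j<T * m. of_bool (j mod m = r) * f j) = (\<Sum>k<T. f (k * m + r))"
proof -
  have "(\<Sum>i<m. of_bool ((k * m + i) mod m = r) * f (k * m + i)) = f (k * m + r)" for k
  proof -
    have "(\<Sum>i<m. of_bool ((k * m + i) mod m = r) * f (k * m + i)) = (\<Sum>i<m. if i = r then f (k * m + i) else 0)"
      by (intro sum.cong) auto
    then show ?thesis using assms by simp
  qed
  then show ?thesis by (simp add: sum_blocks)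
qed

text \<open>Minkowski's inequality for weighted sums. It reduces the Lipschitz estimates for the
  gradient to adding up the coefficients in a list.\<close>

lemma L2_set_le_combination:
  assumes "\<And>i. i \<in> I \<Longrightarrow> \<bar>u i\<bar> \<le> (\<Sum>(c, v)\<leftarrow>ps. c * \<bar>v i\<bar>)"
    and "\<And>c v. (c, v) \<in> set ps \<Longrightarrow> 0 \<le> c \<and> L2_set v I \<le> V"
  shows "L2_set u I \<le> (\<Sum>(c, v)\<leftarrow>ps. c) * V"
proof -
  have "L2_set u I = L2_set (\<lambda>i. \<bar>u i\<bar>) I" by (simp add: L2_set_def)
  also have "\<dots> \<le> L2_set (\<lambda>i. \<Sum>(c, v)\<leftarrow>ps. c * \<bar>v i\<bar>) I"
    using assms(1) by (intro L2_set_mono) auto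
  also have "\<dots> \<le> (\<Sum>(c, v)\<leftarrow>ps. c) * V"
    using assms(2)
  proof (induction ps)
    case Nil
    then show ?case by (simp add: L2_set_def)
  next
    case (Cons a ps)
    obtain c v where a: "a = (c, v)" by force
    have cv: "0 \<le> c" "L2_set v I \<le> V" using Cons.prems[of c v] a by auto
    have "L2_set (\<lambda>i. c * \<bar>v i\<bar> + (\<Sum>(c, v)\<leftarrow>ps. c * \<bar>v i\<bar>)) I
        \<le> L2_set (\<lambda>i. c * \<bar>v i\<bar>) I + L2_set (\<lambda>i. \<Sum>(c, v)\<leftarrow>ps. c * \<bar>v i\<bar>) I"
      by (rule L2_set_triangle_ineq)
    moreover have "L2_set (\<lambda>i. c * \<bar>v i\<bar>) I = c * L2_set (\<lambda>i. \<bar>v i\<bar>) I"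
      using cv(1) by (rule L2_set_right_distrib[symmetric])
    moreover have "L2_set (\<lambda>i. \<bar>v i\<bar>) I = L2_set v I" by (simp add: L2_set_def)
    moreover have "c * L2_set v I \<le> c * V" using cv by (intro mult_left_mono)
    moreover have "L2_set (\<lambda>i. \<Sum>(c, v)\<leftarrow>ps. c * \<bar>v i\<bar>) I \<le> (\<Sum>(c, v)\<leftarrow>ps. c) * V"
      using Cons by auto
    ultimately show ?case by (simp add: a distrib_right)
  qed
  finally show ?thesis .
qed

text \<open>Injectivity of \<open>\<sigma>\<close> means that each coordinate of \<open>v\<close> is
  used at most once, so shifted or block-indexed copies of a vector are no longer than the
  vector.\<close>

lemma L2_set_coord_le_norm:
  fixes v :: rvec
  assumes A: "finite A" and inj: "inj_on \<sigma> {k \<in> A. P k}"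
  shows "L2_set (\<lambda>k. if P k then coord v (\<sigma> k) else 0) A \<le> norm v"
proof -
  obtain d where d: "v \<in> Rn d" using rrvec_of_in_Rn by blast
  let ?I = "\<sigma> ` {k \<in> A. P k}"
  have "(\<Sum>k\<in>A. (if P k then coord v (\<sigma> k) else 0)\<^sup>2) = (\<Sum>k\<in>{k \<in> A. P k}. (coord v (\<sigma> k))\<^sup>2)"
    using A by (intro sum.mono_neutral_cong_right) auto
  also have "\<dots> = (\<Sum>i\<in>?I. (coord v i)\<^sup>2)"
    using inj by (simp add: sum.reindex)
  also have "\<dots> \<le> (\<Sum>i\<in>?I \<union> {..<d}. (coord v i)\<^sup>2)"
    using A by (intro sum_mono2) auto
  also have "\<dots> = (\<Sum>i<d. (coord v i)\<^sup>2)"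
    using A d by (intro sum.mono_neutral_right) (auto simp: Rn_iff)
  also have "\<dots> = (norm v)\<^sup>2" by (simp add: norm2_Rn[OF d])
  finally show ?thesis
    unfolding L2_set_def by (intro real_le_lsqrt) auto
qed

section \<open>The hard instance\<close>

text \<open>The constant \<open>s\<close> acts as a coordinate before the first one and feeds the
  chain. Differences of two such sequences are given by \<open>prev 0\<close>.\<close>

definition prev :: "real \<Rightarrow> rvec \<Rightarrow> nat \<Rightarrow> real" where
  "prev s x k = (case k of 0 \<Rightarrow> s | Suc i \<Rightarrow> coord x i)"

lemma prev_simps [simp]: "prev s x 0 = s" "prev s x (Suc i) = coord x i"
  by (simp_all add: prev_def)

lemma prev_diff: "prev s x k - prev s x' k = prev 0 (x - x') k"
  by (simp add: prev_def coord_simps split: nat.split)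

lemma prev_convex_combination:
  "prev s ((1 - t) *\<^sub>R u + t *\<^sub>R v) k = (1 - t) * prev s u k + t * prev s v k"
  by (simp add: prev_def coord_simps algebra_simps split: nat.split)

lemma continuous_on_prev [continuous_intros]:
  "continuous_on S g \<Longrightarrow> continuous_on S (\<lambda>x. prev s (g x) k)"
  by (cases k) (simp_all add: continuous_intros)

lemma prev_has_derivative [derivative_intros]:
  "(g has_derivative g') (at x within S) \<Longrightarrow>
    ((\<lambda>x. prev s (g x) k) has_derivative (\<lambda>h. prev 0 (g' h) k)) (at x within S)"
  by (cases k) (auto intro: derivative_intros)

locale hard_instance =
  fixes s \<kappa> :: real and n T :: nat
  assumes s_pos: "s > 0" and \<kappa>_pos: "\<kappa> > 0" and n_pos: "n > 0" and T_pos: "T > 0"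
begin

abbreviation m :: nat where "m \<equiv> Suc n"

text \<open>The scaling makes \<open>n * w^2 = 1 / s^2\<close>, so the maximised link value is free
  of \<open>n\<close>, and \<open>\<delta> = w * s^2\<close> bounds every force
  \<open>w * theta x k\<close> on \<open>X\<close>.\<close>

definition w :: real where "w = 1 / (s * sqrt n)"
definition \<delta> :: real where "\<delta> = s / sqrt n"

definition head :: "rvec \<Rightarrow> nat \<Rightarrow> real" where "head y k = coord y (k * m)"
definition tail :: "rvec \<Rightarrow> nat \<Rightarrow> real" where "tail y k = coord y (k * m + n)"

text \<open>\<open>theta\<close> drives the first dual coordinate of a link and \<open>eta\<close>
  the last. Their sum is \<open>a * (a - b)\<close>, with \<open>a\<close> and \<open>b\<close> the
  primal coordinates at the two ends; it is the total load on the pin in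
  \<open>block\<close>.\<close>

definition theta :: "rvec \<Rightarrow> nat \<Rightarrow> real" where
  "theta x k = (prev s x k)\<^sup>2 - (coord x k)\<^sup>2"
definition eta :: "rvec \<Rightarrow> nat \<Rightarrow> real" where
  "eta x k = (coord x k)\<^sup>2 - prev s x k * coord x k"

definition X :: "rvec set" where
  "X = {x \<in> Rn T. \<forall>k<T. 0 \<le> coord x k \<and> coord x k \<le> prev s x k}"

text \<open>The coordinate bound controls the products of primal and dual coordinates in the
  gradient; the norm bound controls the diameter and is independent of \<open>T\<close>.\<close>

definition Y :: "rvec set" where
  "Y = {y \<in> Rn (T * m). (\<forall>j. 0 \<le> coord y j \<and> coord y j \<le> 2 * sqrt n * s) \<and> norm y \<le> 3 * n * s}"

text \<open>The factor \<open>of_bool\<close> removes the spring that would join the last coordinate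
  of a block to the first one of the next.\<close>

definition spring :: "rvec \<Rightarrow> nat \<Rightarrow> real" where
  "spring y j = of_bool (j mod m < n) * huber \<delta> (coord y j - coord y (Suc j))"

definition tension :: "rvec \<Rightarrow> nat \<Rightarrow> real" where
  "tension y j = of_bool (j mod m < n) * clip \<delta> (coord y j - coord y (Suc j))"

text \<open>The last term is a weak spring of stiffness \<open>1 / n\<close> that pins the tail to
  zero and balances the total load on the block.\<close>

definition block :: "rvec \<times> rvec \<Rightarrow> nat \<Rightarrow> real" where
  "block z k = - (5 / 2) * (coord (fst z) k)\<^sup>2
     + w * (theta (fst z) k * head (snd z) k + eta (fst z) k * tail (snd z) k)
     - (tail (snd z) k)\<^sup>2 / (2 * n)"

definition F :: "rvec \<times> rvec \<Rightarrow> real" where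
  "F z = \<kappa> * ((\<Sum>k<T. block z k) - (\<Sum>j<T * m. spring (snd z) j))"

text \<open>Coordinate \<open>k\<close> is the far end of link \<open>k\<close> and the near end of
  link \<open>Suc k\<close>. For \<open>k = T - 1\<close> the second contribution vanishes on
  \<open>Y\<close>, where block \<open>T\<close> is zero.\<close>

definition gx :: "rvec \<times> rvec \<Rightarrow> nat \<Rightarrow> real" where
  "gx z k = - 5 * coord (fst z) k
     + w * ((2 * coord (fst z) k - prev s (fst z) k) * tail (snd z) k
            - 2 * (coord (fst z) k * head (snd z) k))
     + w * (2 * (coord (fst z) k * head (snd z) (Suc k))
            - coord (fst z) (Suc k) * tail (snd z) (Suc k))"

definition gy :: "rvec \<times> rvec \<Rightarrow> nat \<Rightarrow> real" where
  "gy z j = of_bool (j mod m = 0) * (w * theta (fst z) (j div m))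
     + of_bool (j mod m = n) * (w * eta (fst z) (j div m) - coord (snd z) j / n)
     - tension (snd z) j + (case j of 0 \<Rightarrow> 0 | Suc i \<Rightarrow> tension (snd z) i)"

definition G :: "rvec \<times> rvec \<Rightarrow> rvec \<times> rvec" where
  "G z = \<kappa> *\<^sub>R (rvec_of T (gx z), rvec_of (T * m) (gy z))"

definition instance_problem :: problem where
  "instance_problem = \<lparr>dimx = T, dimy = T * m, domX = X, domY = Y, obj = F, grad = G\<rparr>"

lemma sqrt_n: "sqrt n > 0" "sqrt n * sqrt n = n" "sqrt n \<ge> 1"
  using n_pos by auto

lemma w_pos: "w > 0" and w_s: "w * s \<le> 1" and \<delta>_pos: "\<delta> > 0" and w_s2: "w * s\<^sup>2 = \<delta>"
  and w_2: "w\<^sup>2 * n = 1 / s\<^sup>2" and w_bound: "w * (2 * sqrt n * s) = 2"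
  using s_pos sqrt_n by (simp_all add: w_def \<delta>_def power2_eq_square field_simps)

section \<open>Geometry of the feasible sets\<close>

lemma X_D:
  assumes "x \<in> X"
  shows "x \<in> Rn T" "0 \<le> coord x k" "coord x k \<le> prev s x k" "prev s x k \<le> s" "coord x k \<le> s"
    "0 \<le> prev s x k"
proof -
  show R: "x \<in> Rn T" using assms by (simp add: X_def)
  show nn: "0 \<le> coord x k" for k using assms by (cases "k < T") (auto simp: X_def Rn_iff)
  show p0: "0 \<le> prev s x k" for k using s_pos nn by (cases k) auto
  show le: "coord x k \<le> prev s x k" for k
    using assms p0 by (cases "k < T") (auto simp: X_def Rn_iff)
  show ps: "prev s x k \<le> s" for k
  proof (induction k)
    case (Suc k) with le[of k] show ?case by simp
  qed simp
  show "coord x k \<le> s" using ps[of "Suc k"] by simp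
qed

lemma Y_D:
  assumes "y \<in> Y"
  shows "y \<in> Rn (T * m)" "0 \<le> coord y j" "coord y j \<le> 2 * sqrt n * s" "norm y \<le> 3 * n * s"
    "head y T = 0" "tail y T = 0"
  using assms by (auto simp: Y_def Rn_iff head_def tail_def simp del: mult_Suc_right)

lemma theta_eta:
  assumes "x \<in> X"
  shows "0 \<le> theta x k" "theta x k \<le> s\<^sup>2" "theta x k + eta x k = prev s x k * (prev s x k - coord x k)"
    "0 \<le> theta x k + eta x k" "theta x k + eta x k \<le> theta x k"
proof -
  note D = X_D(2-6)[OF assms, of k]
  show "0 \<le> theta x k" using D by (simp add: theta_def power_mono)
  have "(prev s x k)\<^sup>2 \<le> s\<^sup>2" using D by (intro power_mono)
  then show "theta x k \<le> s\<^sup>2"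
    unfolding theta_def using zero_le_power2[of "coord x k"] by linarith
  show eq: "theta x k + eta x k = prev s x k * (prev s x k - coord x k)"
    by (simp add: theta_def eta_def power2_eq_square algebra_simps)
  show "0 \<le> theta x k + eta x k" unfolding eq using D by (intro mult_nonneg_nonneg) auto
  have "coord x k * coord x k \<le> prev s x k * coord x k" using D by (intro mult_right_mono)
  then show "theta x k + eta x k \<le> theta x k" by (simp add: eta_def power2_eq_square)
qed

lemma zero_in_X: "0 \<in> X" and zero_in_Y: "0 \<in> Y"
  using s_pos by (auto simp: X_def Y_def Rn_iff prev_def split: nat.split)

lemma convex_X: "convex X"
proof (rule convexI)
  fix x y u v assume *: "x \<in> X" "y \<in> X" "0 \<le> (u::real)" "0 \<le> v" "u + v = 1"
  have u: "u = 1 - v" using * by simp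
  show "u *\<^sub>R x + v *\<^sub>R y \<in> X"
    unfolding X_def u
  proof (intro CollectI conjI allI impI)
    show "(1 - v) *\<^sub>R x + v *\<^sub>R y \<in> Rn T"
      using X_D(1) * by (auto intro!: subspace_add subspace_scale subspace_Rn)
    fix k
    show "0 \<le> coord ((1 - v) *\<^sub>R x + v *\<^sub>R y) k"
      using X_D(2) * by (auto simp: coord_simps)
    show "coord ((1 - v) *\<^sub>R x + v *\<^sub>R y) k \<le> prev s ((1 - v) *\<^sub>R x + v *\<^sub>R y) k"
      using X_D(3) * by (auto simp: coord_simps prev_convex_combination intro!: add_mono mult_left_mono)
  qed
qed

lemma convex_Y: "convex Y"
proof -
  have "Y = Rn (T * m) \<inter> (\<Inter>j. {y. 0 \<le> coord y j} \<inter> {y. coord y j \<le> 2 * sqrt n * s}) \<inter> cball 0 (3 * n * s)"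
    by (auto simp: Y_def)
  moreover have "convex {y :: rvec. 0 \<le> coord y j}" "convex {y :: rvec. coord y j \<le> c}" for j c
    unfolding coord_eq_inner
    using convex_halfspace_ge[of 0 "Poly_Mapping.single j (1::real)"]
      convex_halfspace_le[of "Poly_Mapping.single j (1::real)" c]
    by (simp_all add: inner_commute)
  ultimately show ?thesis
    using subspace_imp_convex[OF subspace_Rn]
    by (auto intro!: convex_Int convex_INT)
qed

lemma closed_X: "closed X"
proof -
  have "X = Rn T \<inter> {x. \<forall>k. k < T \<longrightarrow> 0 \<le> coord x k} \<inter> {x. \<forall>k. k < T \<longrightarrow> coord x k \<le> prev s x k}"
    by (auto simp: X_def)
  then show ?thesis
    by (auto intro!: closed_Int closed_Rn closed_Collect_all closed_Collect_imp closed_Collect_le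
        continuous_intros)
qed

lemma closed_Y: "closed Y"
proof -
  have "Y = Rn (T * m) \<inter> {y. \<forall>j. 0 \<le> coord y j} \<inter> {y. \<forall>j. coord y j \<le> 2 * sqrt n * s} \<inter> cball 0 (3 * n * s)"
    by (auto simp: Y_def)
  then show ?thesis
    by (auto intro!: closed_Int closed_Rn closed_Collect_all closed_Collect_le
        continuous_intros)
qed

lemma compact_X: "compact X"
proof -
  have "X \<subseteq> {v \<in> Rn T. \<forall>i. \<bar>coord v i\<bar> \<le> s}" using X_D by auto
  then show ?thesis
    using compact_Int_closed[OF compact_box closed_X, of T s] by (simp only: Int_absorb1)
qed

lemma compact_Y: "compact Y"
proof -
  have "Y \<subseteq> {v \<in> Rn (T * m). \<forall>i. \<bar>coord v i\<bar> \<le> 2 * sqrt n * s}" using Y_D by auto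
  then show ?thesis
    using compact_Int_closed[OF compact_box closed_Y, of "T * m" "2 * sqrt n * s"]
    by (simp only: Int_absorb1)
qed

text \<open>A decreasing nonnegative sequence stays so when its tail is set to zero. This is the
  truncation property that \<open>supp_proj\<close> asks for.\<close>

lemma trunc_X: "x \<in> X \<Longrightarrow> rvec_of j (coord x) \<in> X"
  using X_D(1) by (auto simp: X_def Rn_iff coord_rvec_of prev_def s_pos less_imp_le split: nat.split)

lemma trunc_Y:
  assumes "y \<in> Y"
  shows "rvec_of j (coord y) \<in> Y"
proof -
  have R: "rvec_of j (coord y) \<in> Rn (T * m)" using Y_D(1)[OF assms] by (auto simp: Rn_iff coord_rvec_of)
  have "(norm (rvec_of j (coord y)))\<^sup>2 \<le> (norm y)\<^sup>2"
    unfolding norm2_Rn[OF R] norm2_Rn[OF Y_D(1)[OF assms]]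
    by (intro sum_mono) (auto simp: coord_rvec_of)
  then have "norm (rvec_of j (coord y)) \<le> norm y" by simp
  with R Y_D[OF assms] s_pos show ?thesis by (auto simp: Y_def coord_rvec_of)
qed

section \<open>Gradient and concavity of the objective\<close>

lemma head_has_derivative [derivative_intros]:
  "(g has_derivative g') (at x within S) \<Longrightarrow>
    ((\<lambda>x. head (g x) k) has_derivative (\<lambda>h. head (g' h) k)) (at x within S)"
  "(g has_derivative g') (at x within S) \<Longrightarrow>
    ((\<lambda>x. tail (g x) k) has_derivative (\<lambda>h. tail (g' h) k)) (at x within S)"
  by (auto simp: head_def tail_def intro: derivative_intros)

text \<open>The derivative is taken term by term and then regrouped by coordinates: a link
  contributes to two neighbouring primal coordinates, a spring to two neighbouring dual
  ones.\<close>

lemma F_has_derivative: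
  assumes y: "snd z \<in> Rn (T * m)"
  shows "(F has_derivative (\<lambda>h. G z \<bullet> h)) (at z within S)"
proof -
  let ?a = "prev s (fst z)" and ?b = "coord (fst z)"
  define db where "db h k = - 5 * ?b k * coord (fst h) k
     + w * ((2 * ?a k * prev 0 (fst h) k - 2 * ?b k * coord (fst h) k) * head (snd z) k
         + theta (fst z) k * head (snd h) k
         + (2 * ?b k * coord (fst h) k - prev 0 (fst h) k * ?b k - ?a k * coord (fst h) k) * tail (snd z) k
         + eta (fst z) k * tail (snd h) k)
     - tail (snd z) k * tail (snd h) k / n" for h :: "rvec \<times> rvec" and k
  define ds where "ds h j = tension (snd z) j * (coord (snd h) j - coord (snd h) (Suc j))"
    for h :: "rvec \<times> rvec" and j
  have block: "((\<lambda>z. block z k) has_derivative (\<lambda>h. db h k)) (at z within S)" for k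
  proof -
    \<comment> \<open>Naming the reciprocal makes the remaining identity polynomial.\<close>
    define r where "r = 1 / real n"
    have r: "u / real n = r * u" "u / real (2 * n) = r / 2 * u" for u by (simp_all add: r_def)
    show ?thesis
      unfolding block_def theta_def eta_def db_def r
      by (rule has_derivative_eq_rhs, (rule derivative_intros)+)
        (simp add: fun_eq_iff algebra_simps power2_eq_square)
  qed
  have spring: "((\<lambda>z. spring (snd z) j) has_derivative (\<lambda>h. ds h j)) (at z within S)" for j
    unfolding spring_def ds_def tension_def using \<delta>_pos
    by (auto intro!: derivative_eq_intros simp: fun_eq_iff)
  have "(F has_derivative (\<lambda>h. \<kappa> * ((\<Sum>k<T. db h k) - (\<Sum>j<T * m. ds h j)))) (at z within S)"
    unfolding F_def
    by (intro has_derivative_mult_right has_derivative_diff has_derivative_sum block spring)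
  moreover have "\<kappa> * ((\<Sum>k<T. db h k) - (\<Sum>j<T * m. ds h j)) = G z \<bullet> h" for h
  proof -
    define c where "c k = w * (2 * (?a k * head (snd z) k) - ?b k * tail (snd z) k)" for k
    define e where "e k = - 5 * ?b k + w * ((2 * ?b k - ?a k) * tail (snd z) k
            - 2 * (?b k * head (snd z) k))" for k
    \<comment> \<open>Block \<open>T\<close> lies outside the dual space, so the index shift leaves
      no boundary term.\<close>
    have "c T = 0" using y by (simp add: c_def head_def tail_def Rn_iff del: mult_Suc_right)
    then have c: "(\<Sum>k<T. c k * prev 0 (fst h) k) = (\<Sum>k<T. c (Suc k) * coord (fst h) k)"
      unfolding prev_def by (rule sum_shift_down)
    have hd: "(\<Sum>k<T. w * theta (fst z) k * head (snd h) k)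
        = (\<Sum>j<T * m. of_bool (j mod m = 0) * (w * theta (fst z) (j div m) * coord (snd h) j))"
      by (subst sum_residue_class) (simp_all add: head_def div_mult_self3 del: mult_Suc_right)
    have tl: "(\<Sum>k<T. (w * eta (fst z) k - tail (snd z) k / n) * tail (snd h) k)
        = (\<Sum>j<T * m. of_bool (j mod m = n) *
            ((w * eta (fst z) (j div m) - coord (snd z) j / n) * coord (snd h) j))"
      by (subst sum_residue_class) (simp_all add: tail_def div_mult_self3 del: mult_Suc_right)
    \<comment> \<open>The last dual coordinate ends a block and has no outgoing spring.\<close>
    have "tension (snd z) (T * m - 1) = 0"
    proof -
      obtain T' where "T = Suc T'" using T_pos by (cases T) auto
      then have "T * m - 1 = T' * m + n" by simp
      then have "(T * m - 1) mod m = n" by (metis lessI mod_less mod_mult_self3)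
      then show ?thesis by (simp add: tension_def)
    qed
    then have ten: "(\<Sum>j<T * m. tension (snd z) j * coord (snd h) (Suc j))
        = (\<Sum>j<T * m. (case j of 0 \<Rightarrow> 0 | Suc i \<Rightarrow> tension (snd z) i) * coord (snd h) j)"
      by (rule sum_shift_up)
    have "(\<Sum>k<T. db h k) = (\<Sum>k<T. e k * coord (fst h) k) + (\<Sum>k<T. c k * prev 0 (fst h) k)
        + (\<Sum>k<T. w * theta (fst z) k * head (snd h) k)
        + (\<Sum>k<T. (w * eta (fst z) k - tail (snd z) k / n) * tail (snd h) k)"
      unfolding sum.distrib[symmetric]
      by (intro sum.cong refl) (simp add: db_def e_def c_def algebra_simps diff_divide_distrib)
    moreover have "(\<Sum>k<T. e k * coord (fst h) k) + (\<Sum>k<T. c k * prev 0 (fst h) k)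
        = (\<Sum>k<T. gx z k * coord (fst h) k)"
      unfolding c sum.distrib[symmetric]
      by (intro sum.cong refl) (simp add: e_def c_def gx_def algebra_simps)
    moreover have "(\<Sum>j<T * m. ds h j) = (\<Sum>j<T * m. tension (snd z) j * coord (snd h) j)
        - (\<Sum>j<T * m. (case j of 0 \<Rightarrow> 0 | Suc i \<Rightarrow> tension (snd z) i) * coord (snd h) j)"
      unfolding ten[symmetric] sum_subtractf[symmetric]
      by (intro sum.cong refl) (simp add: ds_def algebra_simps)
    moreover have "(\<Sum>j<T * m. gy z j * coord (snd h) j) =
        (\<Sum>k<T. w * theta (fst z) k * head (snd h) k)
        + (\<Sum>k<T. (w * eta (fst z) k - tail (snd z) k / n) * tail (snd h) k)
        - ((\<Sum>j<T * m. tension (snd z) j * coord (snd h) j)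
        - (\<Sum>j<T * m. (case j of 0 \<Rightarrow> 0 | Suc i \<Rightarrow> tension (snd z) i) * coord (snd h) j))"
      unfolding hd tl sum_subtractf[symmetric] sum.distrib[symmetric]
      by (intro sum.cong refl) (simp add: gy_def algebra_simps)
    ultimately have "(\<Sum>k<T. db h k) - (\<Sum>j<T * m. ds h j)
        = (\<Sum>k<T. gx z k * coord (fst h) k) + (\<Sum>j<T * m. gy z j * coord (snd h) j)"
      by linarith
    then show ?thesis
      by (simp add: G_def inner_prod_def inner_rvec_of algebra_simps)
  qed
  ultimately show ?thesis by simp
qed

text \<open>For fixed \<open>x\<close> the objective is affine in \<open>y\<close> apart from the
  concave pins and the negated convex springs.\<close>

lemma F_concave:
  assumes "x \<in> X"
  shows "concave_on Y (\<lambda>y. F (x, y))"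
  unfolding concave_on_def
proof (rule convex_onI)
  fix t :: real and u v :: rvec assume t: "0 < t" "t < 1" and uv: "u \<in> Y" "v \<in> Y"
  define c where "c = (1 - t) *\<^sub>R u + t *\<^sub>R v"
  have block: "(1 - t) * block (x, u) k + t * block (x, v) k \<le> block (x, c) k" for k
  proof -
    have lin: "head c k = (1 - t) * head u k + t * head v k" "tail c k = (1 - t) * tail u k + t * tail v k"
      by (simp_all add: c_def head_def tail_def coord_simps)
    have "block (x, c) k - ((1 - t) * block (x, u) k + t * block (x, v) k)
        = t * (1 - t) * (tail u k - tail v k)\<^sup>2 / (2 * n)"
    proof -
      define r where "r = 1 / (2 * real n)"
      have r: "u / real (2 * n) = r * u" for u by (simp add: r_def)
      show ?thesis
        unfolding block_def fst_conv snd_conv lin r by (simp add: field_simps power2_eq_square)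
    qed
    also have "\<dots> \<ge> 0" using t by simp
    finally show ?thesis by simp
  qed
  have spring: "spring c j \<le> (1 - t) * spring u j + t * spring v j" for j
    using huber_convex[of \<delta> t "coord u j - coord u (Suc j)" "coord v j - coord v (Suc j)"] t \<delta>_pos
    by (auto simp: spring_def c_def coord_simps algebra_simps)
  have "(\<Sum>k<T. (1 - t) * block (x, u) k + t * block (x, v) k) -
      (\<Sum>j<T * m. (1 - t) * spring u j + t * spring v j) \<le> (\<Sum>k<T. block (x, c) k) - (\<Sum>j<T * m. spring c j)"
    by (intro diff_mono sum_mono block spring)
  then have "(1 - t) * ((\<Sum>k<T. block (x, u) k) - (\<Sum>j<T * m. spring u j))
      + t * ((\<Sum>k<T. block (x, v) k) - (\<Sum>j<T * m. spring v j))
      \<le> (\<Sum>k<T. block (x, c) k) - (\<Sum>j<T * m. spring c j)"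
    unfolding sum.distrib sum_distrib_left[symmetric] by (simp only: algebra_simps)
  from mult_left_mono[OF this, of \<kappa>] \<kappa>_pos
  have "(1 - t) * F (x, u) + t * F (x, v) \<le> F (x, c)"
    unfolding F_def snd_conv by (simp only: algebra_simps)
  then show "- F (x, (1 - t) *\<^sub>R u + t *\<^sub>R v) \<le> (1 - t) * - F (x, u) + t * - F (x, v)"
    by (simp add: c_def)
qed (rule convex_Y)

section \<open>Lipschitz continuity of the gradient\<close>

lemma product_Lipschitz:
  assumes "\<bar>x\<bar> \<le> s" "0 \<le> y'" "y' \<le> 2 * sqrt n * s"
  shows "\<bar>w * (x * y) - w * (x' * y')\<bar> \<le> \<bar>y - y'\<bar> + 2 * \<bar>x - x'\<bar>"
proof -
  have "w * (x * y) - w * (x' * y') = w * x * (y - y') + w * y' * (x - x')"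
    by (simp add: algebra_simps)
  also have "\<bar>\<dots>\<bar> \<le> \<bar>w * x\<bar> * \<bar>y - y'\<bar> + \<bar>w * y'\<bar> * \<bar>x - x'\<bar>"
    by (metis abs_mult abs_triangle_ineq)
  \<comment> \<open>The sizes of \<open>X\<close> and \<open>Y\<close> enter here: dual coordinates
    may be as large as \<open>2 * sqrt n * s\<close>, and \<open>w\<close> compensates for this, so
    the constants are free of \<open>n\<close>.\<close>
  also have "\<dots> \<le> 1 * \<bar>y - y'\<bar> + 2 * \<bar>x - x'\<bar>"
  proof (intro add_mono mult_right_mono)
    show "\<bar>w * x\<bar> \<le> 1"
      using order_trans[OF mult_left_mono[OF assms(1)] w_s] w_pos by (simp add: abs_mult)
    show "\<bar>w * y'\<bar> \<le> 2"
      using order_trans[OF mult_left_mono[OF assms(3)] eq_refl[OF w_bound]] w_pos assms(2)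
      by (simp add: abs_mult)
  qed auto
  finally show ?thesis by simp
qed

lemma product_Lipschitz_x:
  assumes "\<bar>x\<bar> \<le> s" "\<bar>y'\<bar> \<le> s"
  shows "\<bar>w * (x * y) - w * (x' * y')\<bar> \<le> \<bar>y - y'\<bar> + \<bar>x - x'\<bar>"
proof -
  have "w * (x * y) - w * (x' * y') = w * x * (y - y') + w * y' * (x - x')"
    by (simp add: algebra_simps)
  also have "\<bar>\<dots>\<bar> \<le> \<bar>w * x\<bar> * \<bar>y - y'\<bar> + \<bar>w * y'\<bar> * \<bar>x - x'\<bar>"
    by (metis abs_mult abs_triangle_ineq)
  also have "\<dots> \<le> 1 * \<bar>y - y'\<bar> + 1 * \<bar>x - x'\<bar>"
  proof (intro add_mono mult_right_mono)
    show "\<bar>w * x\<bar> \<le> 1"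
      using order_trans[OF mult_left_mono[OF assms(1)] w_s] w_pos by (simp add: abs_mult)
    show "\<bar>w * y'\<bar> \<le> 1"
      using order_trans[OF mult_left_mono[OF assms(2)] w_s] w_pos by (simp add: abs_mult)
  qed auto
  finally show ?thesis by simp
qed

lemma gx_Lipschitz:
  assumes z: "z \<in> X \<times> Y" and z': "z' \<in> X \<times> Y"
  shows "L2_set (\<lambda>k. gx z k - gx z' k) {..<T} \<le> 29 * norm (z - z')"
proof -
  define dx where "dx = fst z - fst z'"
  define dy where "dy = snd z - snd z'"
  \<comment> \<open>The coefficients are collected from the terms of \<open>gx\<close>: 17 is 5 from
    the quadratic term plus 4 from each of the three products containing
    \<open>coord (fst z) k\<close>. They add up to 29.\<close>
  define ps where "ps = [(17, coord dx), (2, prev 0 dx), (2, \<lambda>k. coord dx (Suc k)), (2, head dy),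
    (3, tail dy), (2, \<lambda>k. head dy (Suc k)), (1 :: real, \<lambda>k. tail dy (Suc k))]"
  have V: "norm dx \<le> norm (z - z')" "norm dy \<le> norm (z - z')"
    unfolding dx_def dy_def fst_diff[symmetric] snd_diff[symmetric]
    by (metis norm_fst_le norm_snd_le prod.collapse)+
  have "L2_set (\<lambda>k. gx z k - gx z' k) {..<T} \<le> (\<Sum>(c, v)\<leftarrow>ps. c) * norm (z - z')"
  proof (rule L2_set_le_combination)
    fix k
    define b b' a a' bp bp' h h' t t' hp hp' tp tp' where
      defs: "b = coord (fst z) k" "b' = coord (fst z') k" "a = prev s (fst z) k" "a' = prev s (fst z') k"
      "bp = coord (fst z) (Suc k)" "bp' = coord (fst z') (Suc k)"
      "h = head (snd z) k" "h' = head (snd z') k" "t = tail (snd z) k" "t' = tail (snd z') k"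
      "hp = head (snd z) (Suc k)" "hp' = head (snd z') (Suc k)"
      "tp = tail (snd z) (Suc k)" "tp' = tail (snd z') (Suc k)"
    have eq: "gx z k - gx z' k = - 5 * (b - b') + 2 * (w * (b * t) - w * (b' * t'))
        - (w * (a * t) - w * (a' * t')) - 2 * (w * (b * h) - w * (b' * h'))
        + 2 * (w * (b * hp) - w * (b' * hp')) - (w * (bp * tp) - w * (bp' * tp'))"
      unfolding gx_def defs by (simp add: algebra_simps)
    have bds: "\<bar>b\<bar> \<le> s" "\<bar>a\<bar> \<le> s" "\<bar>bp\<bar> \<le> s" "0 \<le> h'" "h' \<le> 2 * sqrt n * s"
      "0 \<le> t'" "t' \<le> 2 * sqrt n * s" "0 \<le> hp'" "hp' \<le> 2 * sqrt n * s"
      "0 \<le> tp'" "tp' \<le> 2 * sqrt n * s"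
      using z z' X_D Y_D by (auto simp: defs head_def tail_def)
    have dfs: "coord dx k = b - b'" "prev 0 dx k = a - a'" "coord dx (Suc k) = bp - bp'"
      "head dy k = h - h'" "tail dy k = t - t'" "head dy (Suc k) = hp - hp'" "tail dy (Suc k) = tp - tp'"
      by (simp_all add: defs dx_def dy_def head_def tail_def coord_simps prev_diff[symmetric])
    have arith: "\<bar>- 5 * d0 + 2 * d1 - d2 - 2 * d3 + 2 * d4 - d5\<bar>
        \<le> 17 * B + (2 * A + (2 * C + (2 * H + (3 * U + (2 * K + (1 * R + 0))))))"
      if "\<bar>d0\<bar> \<le> B" "\<bar>d1\<bar> \<le> U + 2 * B" "\<bar>d2\<bar> \<le> U + 2 * A" "\<bar>d3\<bar> \<le> H + 2 * B"
        "\<bar>d4\<bar> \<le> K + 2 * B" "\<bar>d5\<bar> \<le> R + 2 * C"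
      for d0 d1 d2 d3 d4 d5 A B C H K R U :: real
      using that by linarith
    show "\<bar>gx z k - gx z' k\<bar> \<le> (\<Sum>(c, v)\<leftarrow>ps. c * \<bar>v k\<bar>)"
      unfolding ps_def eq
      unfolding list.map sum_list.Cons sum_list.Nil prod.case dfs
      by (rule arith[OF eq_refl[OF refl] product_Lipschitz[OF bds(1,6,7)]
          product_Lipschitz[OF bds(2,6,7)] product_Lipschitz[OF bds(1,4,5)]
          product_Lipschitz[OF bds(1,8,9)] product_Lipschitz[OF bds(3,10,11)]])
  next
    have "prev 0 dx = (\<lambda>k. if k \<noteq> 0 then coord dx (k - 1) else 0)"
      by (auto simp: prev_def fun_eq_iff split: nat.split)
    moreover have "inj_on (\<lambda>k. k - 1) {k \<in> {..<T}. k \<noteq> 0}" by (auto simp: inj_on_def)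
    ultimately have "L2_set (prev 0 dx) {..<T} \<le> norm dx"
      using L2_set_coord_le_norm[of "{..<T}" "\<lambda>k. k - 1" "\<lambda>k. k \<noteq> 0" dx] by simp
    moreover have "L2_set (\<lambda>k. coord v (\<sigma> k)) {..<T} \<le> norm v" if "inj \<sigma>" for \<sigma> :: "nat \<Rightarrow> nat" and v
      using L2_set_coord_le_norm[of "{..<T}" \<sigma> "\<lambda>_. True" v] inj_on_subset[OF that] by simp
    from this[of id dx] this[of Suc dx] this[of "\<lambda>k. k * m" dy] this[of "\<lambda>k. k * m + n" dy]
      this[of "\<lambda>k. Suc k * m" dy] this[of "\<lambda>k. Suc k * m + n" dy]
    have "L2_set (coord dx) {..<T} \<le> norm dx" "L2_set (\<lambda>k. coord dx (Suc k)) {..<T} \<le> norm dx"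
      "L2_set (head dy) {..<T} \<le> norm dy" "L2_set (tail dy) {..<T} \<le> norm dy"
      "L2_set (\<lambda>k. head dy (Suc k)) {..<T} \<le> norm dy" "L2_set (\<lambda>k. tail dy (Suc k)) {..<T} \<le> norm dy"
      by (auto simp: head_def[abs_def] tail_def[abs_def] inj_def simp del: mult_Suc_right)
    ultimately show "0 \<le> c \<and> L2_set v {..<T} \<le> norm (z - z')" if "(c, v) \<in> set ps" for c v
      using that V unfolding ps_def by (auto intro: order_trans)
  qed
  then show ?thesis by (simp add: ps_def)
qed

lemma tension_Lipschitz:
  "\<bar>tension y j - tension y' j\<bar> \<le> \<bar>coord (y - y') j\<bar> + \<bar>coord (y - y') (Suc j)\<bar>"
  using clip_Lipschitz[of \<delta> "coord y j - coord y (Suc j)" "coord y' j - coord y' (Suc j)"]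
  by (auto simp: tension_def coord_simps)

lemma gy_Lipschitz:
  assumes z: "z \<in> X \<times> Y" and z': "z' \<in> X \<times> Y"
  shows "L2_set (\<lambda>j. gy z j - gy z' j) {..<T * m} \<le> 13 * norm (z - z')"
proof -
  define dx where "dx = fst z - fst z'"
  define dy where "dy = snd z - snd z'"
  \<comment> \<open>These spread the primal differences over the dual positions of residue
    \<open>r\<close>, one per block, so that within a residue class each primal coordinate occurs at
    most once.\<close>
  define P Q where "P r = (\<lambda>j. if j mod m = r \<and> j div m \<noteq> 0 then coord dx (j div m - 1) else 0)"
    and "Q r = (\<lambda>j. if j mod m = r then coord dx (j div m) else 0)" for r
  define ps where "ps = [(2, P 0), (2, Q 0), (1, P n), (3, Q n), (3, coord dy),
     (1, \<lambda>j. coord dy (Suc j)), (1 :: real, prev 0 dy)]"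
  have V: "norm dx \<le> norm (z - z')" "norm dy \<le> norm (z - z')"
    unfolding dx_def dy_def fst_diff[symmetric] snd_diff[symmetric]
    by (metis norm_fst_le norm_snd_le prod.collapse)+
  have "L2_set (\<lambda>j. gy z j - gy z' j) {..<T * m} \<le> (\<Sum>(c, v)\<leftarrow>ps. c) * norm (z - z')"
  proof (rule L2_set_le_combination)
    fix j
    define b b' a a' where
      defs: "b = coord (fst z) (j div m)" "b' = coord (fst z') (j div m)"
      "a = prev s (fst z) (j div m)" "a' = prev s (fst z') (j div m)"
    have bds: "\<bar>b\<bar> \<le> s" "\<bar>a\<bar> \<le> s" "\<bar>b'\<bar> \<le> s" "\<bar>a'\<bar> \<le> s"
      using z z' X_D by (auto simp: defs)
    have dfs: "coord dx (j div m) = b - b'" "prev 0 dx (j div m) = a - a'"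
      by (simp_all add: defs dx_def coord_simps prev_diff[symmetric])
    have P: "P r j = of_bool (j mod m = r) * (a - a')" for r
      by (simp add: P_def dfs(2)[symmetric] prev_def split: nat.split)
    have Q: "Q r j = of_bool (j mod m = r) * (b - b')" for r
      by (simp add: Q_def dfs(1))
    have arith2: "\<bar>d - e - (d' - e')\<bar> \<le> D + E"
      if "\<bar>d - d'\<bar> \<le> D" "\<bar>e - e'\<bar> \<le> E" for d e d' e' D E :: real
      using that by linarith
    have th: "\<bar>w * theta (fst z) (j div m) - w * theta (fst z') (j div m)\<bar>
        \<le> 2 * \<bar>a - a'\<bar> + 2 * \<bar>b - b'\<bar>"
      using arith2[OF product_Lipschitz_x[OF bds(2,4), of a a'] product_Lipschitz_x[OF bds(1,3), of b b']]
      unfolding theta_def defs[symmetric] power2_eq_square right_diff_distrib by simp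
    have et: "\<bar>w * eta (fst z) (j div m) - w * eta (fst z') (j div m)\<bar>
        \<le> \<bar>a - a'\<bar> + 3 * \<bar>b - b'\<bar>"
      using arith2[OF product_Lipschitz_x[OF bds(1,3), of b b'] product_Lipschitz_x[OF bds(2,3), of b a']]
      unfolding eta_def defs[symmetric] power2_eq_square right_diff_distrib by simp
    have pin: "\<bar>coord (snd z) j / n - coord (snd z') j / n\<bar> \<le> \<bar>coord dy j\<bar>"
    proof -
      have "\<bar>coord (snd z) j / n - coord (snd z') j / n\<bar> = \<bar>coord dy j\<bar> / n"
        by (simp add: dy_def coord_simps diff_divide_distrib[symmetric])
      also have "\<dots> \<le> \<bar>coord dy j\<bar> / 1" using n_pos by (intro divide_left_mono) auto
      finally show ?thesis by simp
    qed
    have shift: "\<bar>(case j of 0 \<Rightarrow> 0 | Suc i \<Rightarrow> tension (snd z) i) - (case j of 0 \<Rightarrow> 0 | Suc i \<Rightarrow> tension (snd z') i)\<bar>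
        \<le> \<bar>prev 0 dy j\<bar> + \<bar>coord dy j\<bar>"
      using tension_Lipschitz[of "snd z" _ "snd z'"] by (cases j) (auto simp: dy_def)
    have eq: "gy z j - gy z' j = of_bool (j mod m = 0) *
          (w * theta (fst z) (j div m) - w * theta (fst z') (j div m))
        + of_bool (j mod m = n) * ((w * eta (fst z) (j div m) - w * eta (fst z') (j div m))
            - (coord (snd z) j / n - coord (snd z') j / n))
        - (tension (snd z) j - tension (snd z') j)
        + ((case j of 0 \<Rightarrow> 0 | Suc i \<Rightarrow> tension (snd z) i) - (case j of 0 \<Rightarrow> 0 | Suc i \<Rightarrow> tension (snd z') i))"
      unfolding gy_def by (simp only: algebra_simps)
    have arith: "\<bar>of_bool p * d1 + of_bool r * (d2 - d3) - d4 + d5\<bar>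
        \<le> 2 * \<bar>of_bool p * A\<bar> + (2 * \<bar>of_bool p * B\<bar> + (1 * \<bar>of_bool r * A\<bar>
          + (3 * \<bar>of_bool r * B\<bar> + (3 * U + (1 * V + (1 * R + 0))))))"
      if "\<bar>d1\<bar> \<le> 2 * \<bar>A\<bar> + 2 * \<bar>B\<bar>" "\<bar>d2\<bar> \<le> \<bar>A\<bar> + 3 * \<bar>B\<bar>" "\<bar>d3\<bar> \<le> U" "\<bar>d4\<bar> \<le> U + V" "\<bar>d5\<bar> \<le> R + U"
      for d1 d2 d3 d4 d5 A B U V R :: real and p r
      using that by (cases p; cases r) (simp_all, linarith+)
    show "\<bar>gy z j - gy z' j\<bar> \<le> (\<Sum>(c, v)\<leftarrow>ps. c * \<bar>v j\<bar>)"
      unfolding ps_def eq list.map sum_list.Cons sum_list.Nil prod.case P Q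
      by (rule arith[OF th et pin tension_Lipschitz[of "snd z" j "snd z'", folded dy_def] shift])
  next
    have P: "L2_set (P r) {..<T * m} \<le> norm dx" for r
      unfolding P_def
    proof (rule L2_set_coord_le_norm)
      show "inj_on (\<lambda>j. j div m - 1) {j \<in> {..<T * m}. j mod m = r \<and> j div m \<noteq> 0}"
      proof (rule inj_onI)
        fix i j assume "i \<in> {j \<in> {..<T * m}. j mod m = r \<and> j div m \<noteq> 0}"
          "j \<in> {j \<in> {..<T * m}. j mod m = r \<and> j div m \<noteq> 0}" "i div m - 1 = j div m - 1"
        then have "i div m = j div m" "i mod m = j mod m" by auto
        then show "i = j" by (metis div_mult_mod_eq)
      qed
    qed simp
    have Q: "L2_set (Q r) {..<T * m} \<le> norm dx" for r
      unfolding Q_def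
    proof (rule L2_set_coord_le_norm)
      show "inj_on (\<lambda>j. j div m) {j \<in> {..<T * m}. j mod m = r}"
        by (rule inj_onI) (metis (mono_tags, lifting) div_mult_mod_eq mem_Collect_eq)
    qed simp
    have "prev 0 dy = (\<lambda>k. if k \<noteq> 0 then coord dy (k - 1) else 0)"
      by (auto simp: prev_def fun_eq_iff split: nat.split)
    moreover have "inj_on (\<lambda>k. k - 1) {k \<in> {..<T * m}. k \<noteq> 0}" by (auto simp: inj_on_def)
    ultimately have prev: "L2_set (prev 0 dy) {..<T * m} \<le> norm dy"
      using L2_set_coord_le_norm[of "{..<T * m}" "\<lambda>k. k - 1" "\<lambda>k. k \<noteq> 0" dy] by simp
    have "L2_set (\<lambda>k. coord v (\<sigma> k)) {..<T * m} \<le> norm v" if "inj \<sigma>" for \<sigma> :: "nat \<Rightarrow> nat" and v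
      using L2_set_coord_le_norm[of "{..<T * m}" \<sigma> "\<lambda>_. True" v] inj_on_subset[OF that] by simp
    from this[of id dy] this[of Suc dy]
    have "L2_set (coord dy) {..<T * m} \<le> norm dy" "L2_set (\<lambda>k. coord dy (Suc k)) {..<T * m} \<le> norm dy"
      by simp_all
    with prev P Q show "0 \<le> c \<and> L2_set v {..<T * m} \<le> norm (z - z')" if "(c, v) \<in> set ps" for c v
      using that V unfolding ps_def by (auto intro: order_trans)
  qed
  then show ?thesis by (simp add: ps_def)
qed

text \<open>The estimates for the two components add up to 29 + 13. The class constant is
  \<open>64 * \<kappa>\<close>, which also accommodates the weak convexity bound.\<close>

lemma G_Lipschitz: "(42 * \<kappa>)-lipschitz_on (X \<times> Y) G"
proof (rule lipschitz_onI)
  fix z z' assume z: "z \<in> X \<times> Y" "z' \<in> X \<times> Y"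
  have vec_diff: "rvec_of d g - rvec_of d g' = rvec_of d (\<lambda>i. g i - g' i)" for d g g'
    by (intro poly_mapping_eqI) (simp add: coord_simps coord_rvec_of)
  have nv: "norm (rvec_of d g) = L2_set g {..<d}" for d g
    by (simp add: norm_Rn[OF rvec_of_in_Rn] coord_rvec_of L2_set_def)
  have "dist (G z) (G z') = \<kappa> * norm ((rvec_of T (gx z), rvec_of (T * m) (gy z)) - (rvec_of T (gx z'), rvec_of (T * m) (gy z')))"
    unfolding dist_norm G_def scaleR_diff_right[symmetric] using \<kappa>_pos by (simp only: norm_scaleR abs_of_pos)
  also have "\<dots> \<le> \<kappa> * (L2_set (\<lambda>k. gx z k - gx z' k) {..<T} + L2_set (\<lambda>j. gy z j - gy z' j) {..<T * m})"
    using \<kappa>_pos norm_Pair_le[of "rvec_of T (\<lambda>k. gx z k - gx z' k)" "rvec_of (T * m) (\<lambda>j. gy z j - gy z' j)"]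
    by (intro mult_left_mono) (simp_all add: vec_diff nv del: mult_Suc_right)
  also have "\<dots> \<le> \<kappa> * (29 * norm (z - z') + 13 * norm (z - z'))"
    using \<kappa>_pos by (intro mult_left_mono add_mono gx_Lipschitz gy_Lipschitz z) auto
  finally show "dist (G z) (G z') \<le> 42 * \<kappa> * dist z z'" by (simp add: dist_norm)
qed (use \<kappa>_pos in simp)

section \<open>Maximisation over the dual variable\<close>

definition link :: "rvec \<Rightarrow> nat \<Rightarrow> real" where
  "link x k = - (5 / 2) * (coord x k)\<^sup>2
     + ((theta x k)\<^sup>2 + (prev s x k * (prev s x k - coord x k))\<^sup>2) / (2 * s\<^sup>2)"

definition Psi :: "rvec \<Rightarrow> real" where
  "Psi x = \<kappa> * (\<Sum>k<T. link x k)"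

lemma sum_springs:
  "(\<Sum>j<T * m. spring y j) =
    (\<Sum>k<T. \<Sum>i<n. huber \<delta> (coord y (k * m + i) - coord y (k * m + Suc i)))"
proof -
  have "spring y (k * m + i) =
      of_bool (i < n) * huber \<delta> (coord y (k * m + i) - coord y (k * m + Suc i))" if "i < m" for k i
    using that by (simp add: spring_def del: mult_Suc_right)
  then show ?thesis
    unfolding sum_blocks by (simp del: mult_Suc_right)
qed

lemma F_blocks:
  "F (x, y) = \<kappa> * (\<Sum>k<T. block (x, y) k
     - (\<Sum>i<n. huber \<delta> (coord y (k * m + i) - coord y (k * m + Suc i))))"
  by (simp only: F_def sum_springs sum_subtractf fst_conv snd_conv)

lemma head_minus_tail: "head y k - tail y k = (\<Sum>i<n. coord y (k * m + i) - coord y (k * m + Suc i))"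
  using sum_lessThan_telescope'[of "\<lambda>i. coord y (k * m + i)" n]
  by (simp add: head_def tail_def del: mult_Suc_right)

lemma theta_force:
  assumes "x \<in> X"
  shows "\<bar>w * theta x k\<bar> \<le> \<delta>"
  using mult_left_mono[OF theta_eta(2)[OF assms, of k], of w] theta_eta(1)[OF assms, of k] w_pos w_s2
  by (simp add: abs_mult)

lemma w_sq: "n * (w * c)\<^sup>2 / 2 = c\<^sup>2 / (2 * s\<^sup>2)"
proof -
  have "n * (w * c)\<^sup>2 / 2 = (w\<^sup>2 * n) * c\<^sup>2 / 2" by (simp add: power_mult_distrib)
  then show ?thesis unfolding w_2 by simp
qed

text \<open>Writing the head as the tail plus all extensions splits a link into independent
  problems: each spring is bounded by Fenchel-Young, the pin by completing a square.\<close>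

lemma F_le_Psi:
  assumes "x \<in> X"
  shows "F (x, y) \<le> Psi x"
  unfolding F_blocks Psi_def
proof (intro mult_left_mono sum_mono)
  fix k
  define d where "d i = coord y (k * m + i) - coord y (k * m + Suc i)" for i
  define \<psi> where "\<psi> = prev s x k * (prev s x k - coord x k)"
  have \<psi>: "eta x k = \<psi> - theta x k" using theta_eta(3)[OF assms, of k] by (simp add: \<psi>_def)
  have hd: "head y k = tail y k + (\<Sum>i<n. d i)"
    using head_minus_tail[of y k] by (simp add: d_def)
  have "(\<Sum>i<n. w * theta x k * d i - huber \<delta> (d i)) \<le> (\<Sum>i<n. (w * theta x k)\<^sup>2 / 2)"
    by (intro sum_mono huber_conjugate theta_force assms)
  also have "\<dots> = (theta x k)\<^sup>2 / (2 * s\<^sup>2)" using w_sq[of "theta x k"] by simp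
  finally have 1: "w * theta x k * (\<Sum>i<n. d i) - (\<Sum>i<n. huber \<delta> (d i)) \<le> (theta x k)\<^sup>2 / (2 * s\<^sup>2)"
    by (simp add: sum_subtractf sum_distrib_left)
  have "0 \<le> (tail y k - n * (w * \<psi>))\<^sup>2 / (2 * n)" by simp
  also have "\<dots> = (tail y k)\<^sup>2 / (2 * n) - w * \<psi> * tail y k + n * (w * \<psi>)\<^sup>2 / 2"
    using n_pos by (simp add: power2_eq_square field_simps)
  finally have 2: "w * \<psi> * tail y k - (tail y k)\<^sup>2 / (2 * n) \<le> \<psi>\<^sup>2 / (2 * s\<^sup>2)"
    unfolding w_sq by simp
  have "block (x, y) k - (\<Sum>i<n. huber \<delta> (d i)) = - (5 / 2) * (coord x k)\<^sup>2
      + (w * theta x k * (\<Sum>i<n. d i) - (\<Sum>i<n. huber \<delta> (d i)))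
      + (w * \<psi> * tail y k - (tail y k)\<^sup>2 / (2 * n))"
    unfolding block_def fst_conv snd_conv \<psi> hd by (simp add: algebra_simps)
  also have "\<dots> \<le> link x k"
    using 1 2 by (simp add: link_def \<psi>_def add_divide_distrib)
  finally show "block (x, y) k - (\<Sum>i<n. huber \<delta> (coord y (k * m + i) - coord y (k * m + Suc i)))
      \<le> link x k" by (simp add: d_def)
qed (use \<kappa>_pos in simp)

text \<open>The equilibrium: every spring of block \<open>k\<close> is stretched by
  \<open>w * theta x k\<close>, and the tail sits where the pin of stiffness \<open>1 / n\<close>
  balances the total load.\<close>

definition ystar :: "rvec \<Rightarrow> rvec" where
  "ystar x = rvec_of (T * m) (\<lambda>j. n * w * (theta x (j div m) + eta x (j div m))
     + real (n - j mod m) * (w * theta x (j div m)))"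

lemma coord_ystar:
  assumes "k < T" "i < m"
  shows "coord (ystar x) (k * m + i) = n * w * (theta x k + eta x k) + real (n - i) * (w * theta x k)"
proof -
  have "k * m + i < Suc k * m" using assms by simp
  also have "\<dots> \<le> T * m" using assms by (intro mult_le_mono1) simp
  finally show ?thesis using assms by (simp add: ystar_def coord_rvec_of del: mult_Suc_right mult_Suc)
qed

lemma F_ystar:
  assumes "x \<in> X"
  shows "F (x, ystar x) = Psi x"
  unfolding F_blocks Psi_def
proof (intro arg_cong[of _ _ "(*) \<kappa>"] sum.cong refl)
  fix k assume "k \<in> {..<T}"
  then have k: "k < T" by simp
  let ?y = "ystar x"
  have d: "coord ?y (k * m + i) - coord ?y (k * m + Suc i) = w * theta x k" if "i < n" for i
  proof -
    have "real (n - i) = real (n - Suc i) + 1" using that by auto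
    moreover have "coord ?y (k * m + i) = n * w * (theta x k + eta x k) + real (n - i) * (w * theta x k)"
      "coord ?y (k * m + Suc i) = n * w * (theta x k + eta x k) + real (n - Suc i) * (w * theta x k)"
      using that by (simp_all only: coord_ystar[OF k] less_SucI Suc_less_eq)
    ultimately show ?thesis by (simp only: distrib_right mult_1)
  qed
  have tl: "tail ?y k = n * (w * (theta x k + eta x k))"
    using coord_ystar[OF k, of n] by (simp add: tail_def)
  have hd: "head ?y k = tail ?y k + n * (w * theta x k)"
    using head_minus_tail[of ?y k] d by simp
  have hub: "(\<Sum>i<n. huber \<delta> (coord ?y (k * m + i) - coord ?y (k * m + Suc i))) = n * (w * theta x k)\<^sup>2 / 2"
    using d huber_conjugate(2)[OF theta_force[OF assms, of k]] by simp
  have "block (x, ?y) k - n * (w * theta x k)\<^sup>2 / 2 = - (5 / 2) * (coord x k)\<^sup>2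
      + n * (w * theta x k)\<^sup>2 / 2 + n * (w * (theta x k + eta x k))\<^sup>2 / 2"
    unfolding block_def fst_conv snd_conv hd tl using n_pos
    by (simp add: power2_eq_square field_simps)
  then show "block (x, ?y) k - (\<Sum>i<n. huber \<delta> (coord ?y (k * m + i) - coord ?y (k * m + Suc i))) = link x k"
    unfolding hub w_sq by (simp add: link_def theta_eta(3)[OF assms, symmetric] add_divide_distrib)
qed

lemma sum_theta: "(\<Sum>k<N. theta x k) = s\<^sup>2 - (prev s x N)\<^sup>2"
  by (induction N) (simp_all add: theta_def)

text \<open>Coordinates in block \<open>k\<close> are at most
  \<open>2 * (n * w * theta x k)\<close>. As \<open>(theta x k)^2 \<le> s^2 * theta x k\<close>, the
  squared norm is controlled by the sum of the \<open>theta x k\<close>, which telescopes to at most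
  \<open>s^2\<close> however long the chain is.\<close>

lemma ystar_in_Y:
  assumes x: "x \<in> X"
  shows "ystar x \<in> Y"
proof -
  have R: "ystar x \<in> Rn (T * m)" by (simp only: ystar_def rvec_of_in_Rn)
  have nws: "2 * (n * w * s\<^sup>2) = 2 * sqrt n * s"
  proof -
    have "n * w * s\<^sup>2 = n * \<delta>" using w_s2 by (simp add: mult.assoc)
    also have "\<dots> = n / sqrt n * s" by (simp add: \<delta>_def)
    also have "\<dots> = sqrt n * s" by (simp only: real_div_sqrt of_nat_0_le_iff)
    finally show ?thesis by simp
  qed
  have nn: "0 \<le> coord (ystar x) j" for j
    using theta_eta[OF x] w_pos by (simp add: ystar_def coord_rvec_of)
  have le: "coord (ystar x) (k * m + i) \<le> 2 * (n * w * theta x k)" if "k < T" "i < m" for k i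
  proof -
    have "n * w * (theta x k + eta x k) \<le> n * w * theta x k"
      using theta_eta(5)[OF x] w_pos by (intro mult_left_mono) auto
    moreover have "real (n - i) * (w * theta x k) \<le> n * (w * theta x k)"
      using theta_eta(1)[OF x] w_pos by (intro mult_right_mono) auto
    ultimately show ?thesis unfolding coord_ystar[OF that] by simp
  qed
  have ub: "coord (ystar x) j \<le> 2 * sqrt n * s" for j
  proof (cases "j < T * m")
    case True
    have k: "j div m < T" using True by (simp add: less_mult_imp_div_less)
    have "coord (ystar x) (j div m * m + j mod m) \<le> 2 * (n * w * theta x (j div m))"
      by (intro le k) simp
    also have "\<dots> \<le> 2 * (n * w * s\<^sup>2)"
      using theta_eta(2)[OF x] w_pos by (intro mult_left_mono) auto
    finally show ?thesis by (simp add: nws del: mult_Suc_right)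
  next
    case False
    then show ?thesis using R s_pos by (simp add: Rn_iff del: mult_Suc_right)
  qed
  have "(norm (ystar x))\<^sup>2 = (\<Sum>k<T. \<Sum>i<m. (coord (ystar x) (k * m + i))\<^sup>2)"
    by (simp only: norm2_Rn[OF R] sum_blocks)
  also have "\<dots> \<le> (\<Sum>k<T. \<Sum>i<m. (2 * (n * w * theta x k))\<^sup>2)"
    using nn le by (intro sum_mono power_mono) auto
  also have "\<dots> = (\<Sum>k<T. m * (4 * n * (w\<^sup>2 * n) * (theta x k)\<^sup>2))"
    by (simp add: power_mult_distrib power2_eq_square mult_ac)
  \<comment> \<open>The factor \<open>2 * n\<close> absorbs the block length
    \<open>m = n + 1\<close>.\<close>
  also have "\<dots> \<le> (\<Sum>k<T. (2 * n) * (4 * n * theta x k))"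
  proof (rule sum_mono, rule mult_mono)
    fix k
    have "(theta x k)\<^sup>2 \<le> s\<^sup>2 * theta x k"
      unfolding power2_eq_square[of "theta x k"] using theta_eta[OF x] by (intro mult_right_mono) auto
    then have "(theta x k)\<^sup>2 / s\<^sup>2 \<le> theta x k" using s_pos by (simp add: field_simps)
    then have "4 * n * ((theta x k)\<^sup>2 / s\<^sup>2) \<le> 4 * n * theta x k" by (intro mult_left_mono) auto
    then show "4 * n * (w\<^sup>2 * n) * (theta x k)\<^sup>2 \<le> 4 * n * theta x k"
      unfolding w_2 by simp
  qed (use n_pos in auto)
  also have "\<dots> = 8 * n\<^sup>2 * (\<Sum>k<T. theta x k)"
    by (simp add: sum_distrib_left power2_eq_square mult_ac)
  also have "\<dots> \<le> 8 * n\<^sup>2 * s\<^sup>2" unfolding sum_theta by (intro mult_left_mono) auto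
  also have "\<dots> \<le> 9 * (n\<^sup>2 * s\<^sup>2)" by simp
  also have "\<dots> = (3 * n * s)\<^sup>2" by (simp add: power_mult_distrib)
  finally have "norm (ystar x) \<le> 3 * n * s" by (rule power2_le_imp_le) (use s_pos in simp)
  with R nn ub show ?thesis by (simp add: Y_def del: mult_Suc_right)
qed

lemma Phi_eq:
  assumes "x \<in> X"
  shows "Phi instance_problem x = Psi x"
  unfolding Phi_def instance_problem_def problem.simps
  by (rule cSup_eq_maximum)
    (use F_ystar[OF assms] ystar_in_Y[OF assms] F_le_Psi[OF assms] in \<open>force+\<close>)

section \<open>Weak convexity and stationarity of the primal function\<close>

lemma sum_prev_diff: "(\<Sum>k<N. (prev 0 v k)\<^sup>2) \<le> (\<Sum>k<N. (coord v k)\<^sup>2)"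
proof (cases N)
  case (Suc M)
  have "(\<Sum>k<Suc M. (prev 0 v k)\<^sup>2) = (\<Sum>k<M. (coord v k)\<^sup>2)"
    by (subst sum.lessThan_Suc_shift) simp
  then show ?thesis using Suc by simp
qed simp

text \<open>For fixed \<open>y\<close> the objective is quadratic in \<open>x\<close> up to springs
  that do not involve \<open>x\<close>, so its deviation from linear interpolation is exactly a
  quadratic form in \<open>u - v\<close>. The form is bounded because
  \<open>w * coord y j \<le> 2\<close>.\<close>

lemma F_weakly_convex:
  assumes u: "u \<in> X" and v: "v \<in> X" and y: "y \<in> Y" and t: "0 \<le> t" "t \<le> 1"
  shows "F ((1 - t) *\<^sub>R u + t *\<^sub>R v, y) \<le> (1 - t) * F (u, y) + t * F (v, y)
    + 32 * \<kappa> * t * (1 - t) * (norm (u - v))\<^sup>2"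
proof -
  define c where "c = (1 - t) *\<^sub>R u + t *\<^sub>R v"
  define a b where "a k = prev 0 (u - v) k" and "b k = coord (u - v) k" for k
  have block: "block (c, y) k \<le> (1 - t) * block (u, y) k + t * block (v, y) k
      + t * (1 - t) * (16 * (b k)\<^sup>2 + 16 * (a k)\<^sup>2)" for k
  proof -
    define Q where "Q = - (5 / 2) * (b k)\<^sup>2 + ((a k)\<^sup>2 - (b k)\<^sup>2) * (w * head y k)
      + ((b k)\<^sup>2 - a k * b k) * (w * tail y k)"
    have ab: "prev s u k = prev s v k + a k" "coord u k = coord v k + b k"
      by (simp_all add: a_def b_def prev_diff[where s = s, symmetric] coord_simps)
    have cab: "prev s c k = prev s v k + (1 - t) * a k" "coord c k = coord v k + (1 - t) * b k"
      unfolding c_def prev_convex_combination coord_simps ab by (simp_all add: algebra_simps)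
    have eq: "block (c, y) k = (1 - t) * block (u, y) k + t * block (v, y) k - t * (1 - t) * Q"
    proof -
      define r where "r = 1 / (2 * real n)"
      have r: "u / real (2 * n) = r * u" for u by (simp add: r_def)
      show ?thesis
        unfolding block_def theta_def eta_def fst_conv snd_conv ab cab Q_def r
        by (simp add: field_simps power2_eq_square)
    qed
    have wb: "0 \<le> w * coord y j" "w * coord y j \<le> 2" for j
      using Y_D(2,3)[OF y, of j] w_pos mult_left_mono[of "coord y j" "2 * sqrt n * s" w]
      unfolding w_bound by auto
    have "(b k)\<^sup>2 * (w * head y k) \<le> (b k)\<^sup>2 * 2"
      unfolding head_def by (intro mult_left_mono wb) auto
    moreover have "a k * b k * (w * tail y k) \<le> 2 * ((a k)\<^sup>2 + (b k)\<^sup>2)"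
    proof -
      have "a k * b k * (w * tail y k) \<le> \<bar>a k * b k\<bar> * (w * tail y k)"
        unfolding tail_def by (intro mult_right_mono wb) auto
      also have "\<dots> \<le> \<bar>a k * b k\<bar> * 2" unfolding tail_def by (intro mult_left_mono wb) auto
      also have "\<bar>a k * b k\<bar> \<le> (a k)\<^sup>2 + (b k)\<^sup>2"
        using sum_squares_bound[of "a k" "b k"] sum_squares_bound[of "a k" "- b k"]
          zero_le_power2[of "a k"] zero_le_power2[of "b k"] by (auto simp: abs_le_iff)
      finally show ?thesis by simp
    qed
    moreover have "0 \<le> (a k)\<^sup>2 * (w * head y k)" "0 \<le> (b k)\<^sup>2 * (w * tail y k)"
      unfolding head_def tail_def by (intro mult_nonneg_nonneg wb; simp)+
    moreover have "- Q = 5 / 2 * (b k)\<^sup>2 - (a k)\<^sup>2 * (w * head y k) + (b k)\<^sup>2 * (w * head y k)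
        - (b k)\<^sup>2 * (w * tail y k) + a k * b k * (w * tail y k)"
      unfolding Q_def left_diff_distrib by simp
    ultimately have "- Q \<le> 16 * (b k)\<^sup>2 + 16 * (a k)\<^sup>2"
      using zero_le_power2[of "a k"] zero_le_power2[of "b k"] by argo
    then have "t * (1 - t) * (- Q) \<le> t * (1 - t) * (16 * (b k)\<^sup>2 + 16 * (a k)\<^sup>2)"
      using t by (intro mult_left_mono) auto
    then show ?thesis unfolding eq by linarith
  qed
  have uv: "u - v \<in> Rn T" using X_D(1) u v by (simp add: subspace_diff subspace_Rn)
  have sq: "(\<Sum>k<T. 16 * (b k)\<^sup>2 + 16 * (a k)\<^sup>2) \<le> 32 * (norm (u - v))\<^sup>2"
    using sum_prev_diff[of "u - v" T]
    by (simp add: sum.distrib sum_distrib_left[symmetric] norm2_Rn[OF uv] a_def b_def)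
  have "(\<Sum>k<T. block (c, y) k) \<le> (\<Sum>k<T. (1 - t) * block (u, y) k + t * block (v, y) k
      + t * (1 - t) * (16 * (b k)\<^sup>2 + 16 * (a k)\<^sup>2))"
    by (intro sum_mono block)
  also have "\<dots> = (1 - t) * (\<Sum>k<T. block (u, y) k) + t * (\<Sum>k<T. block (v, y) k)
      + t * (1 - t) * (\<Sum>k<T. 16 * (b k)\<^sup>2 + 16 * (a k)\<^sup>2)"
    by (simp add: sum.distrib sum_distrib_left distrib_left)
  also have "\<dots> \<le> (1 - t) * (\<Sum>k<T. block (u, y) k) + t * (\<Sum>k<T. block (v, y) k)
      + t * (1 - t) * (32 * (norm (u - v))\<^sup>2)"
    using t by (intro add_left_mono mult_left_mono sq) auto
  finally have "(\<Sum>k<T. block (c, y) k) - (\<Sum>j<T * m. spring y j)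
      \<le> (1 - t) * ((\<Sum>k<T. block (u, y) k) - (\<Sum>j<T * m. spring y j))
        + t * ((\<Sum>k<T. block (v, y) k) - (\<Sum>j<T * m. spring y j))
        + 32 * t * (1 - t) * (norm (u - v))\<^sup>2"
    by (simp add: algebra_simps)
  from mult_left_mono[OF this, of \<kappa>] \<kappa>_pos show ?thesis
    unfolding F_def snd_conv c_def[symmetric] by (simp add: algebra_simps)
qed

text \<open>Weak convexity of \<open>F\<close> for the single dual point \<open>ystar c\<close>
  passes to \<open>Psi\<close>, since \<open>F\<close> equals \<open>Psi\<close> there at
  \<open>c\<close> and is below \<open>Psi\<close> at \<open>u\<close> and \<open>v\<close>. The
  factor \<open>32 * \<kappa>\<close> is half of \<open>64 * \<kappa>\<close>.\<close>

sublocale weakly_convex X Psi "64 * \<kappa>"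
proof
  show "continuous_on X Psi"
    unfolding Psi_def link_def theta_def using s_pos by (auto intro!: continuous_intros)
  fix u v t assume uv: "u \<in> X" "v \<in> X" and t: "0 \<le> t" "t \<le> (1::real)"
  define c where "c = (1 - t) *\<^sub>R u + t *\<^sub>R v"
  have c: "c \<in> X" using convexD[OF convex_X uv, of "1 - t" t] t by (simp add: c_def)
  have "Psi c \<le> (1 - t) * F (u, ystar c) + t * F (v, ystar c)
      + 32 * \<kappa> * t * (1 - t) * (norm (u - v))\<^sup>2"
    using F_weakly_convex[OF uv ystar_in_Y[OF c] t] unfolding c_def[symmetric] F_ystar[OF c] .
  also have "\<dots> \<le> (1 - t) * Psi u + t * Psi v + 32 * \<kappa> * t * (1 - t) * (norm (u - v))\<^sup>2"
    using t uv by (intro add_right_mono add_mono mult_left_mono F_le_Psi) auto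
  finally show "Psi ((1 - t) *\<^sub>R u + t *\<^sub>R v) \<le> (1 - t) * Psi u + t * Psi v
      + 64 * \<kappa> / 2 * t * (1 - t) * (norm (u - v))\<^sup>2"
    by (simp add: c_def)
qed (use \<kappa>_pos compact_X convex_X zero_in_X in auto)

text \<open>Off \<open>X\<close> the extended function is infinite, so the infimum over
  \<open>Rn T\<close> is the proximal problem for \<open>Psi\<close> on \<open>X\<close>, and the
  gradient formula for the envelope applies.\<close>

lemma stationarity_measure_eq:
  assumes x: "x \<in> X" and p: "is_prox X Psi (64 * \<kappa>) x p"
  shows "stationarity_measure (64 * \<kappa>) instance_problem x = 2 * (64 * \<kappa>) * norm (x - p)"
proof -
  define L where "L = 64 * \<kappa>"
  have L: "L > 0" using \<kappa>_pos by (simp add: L_def)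
  let ?M = "\<lambda>x. real_of_ereal (moreau_envelope T (phi instance_problem) (1 / (2 * L)) x)"
  have M: "\<exists>q. is_prox X Psi L x q \<and> ?M x = Psi q + L * (norm (q - x))\<^sup>2" for x
  proof -
    obtain q where q: "is_prox X Psi L x q" using prox_exists L_def by blast
    have dom: "domX instance_problem = X" by (simp add: instance_problem_def)
    have "moreau_envelope T (phi instance_problem) (1 / (2 * L)) x = ereal (Psi q + L * (norm (q - x))\<^sup>2)"
      unfolding moreau_envelope_def
    proof (rule INF_eqI)
      fix v
      show "ereal (Psi q + L * (norm (q - x))\<^sup>2)
          \<le> phi instance_problem v + ereal (1 / (2 * (1 / (2 * L))) * (norm (v - x))\<^sup>2)"
        using q L by (cases "v \<in> X") (auto simp: phi_def convex_indicator_def dom is_prox_def Phi_eq)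
    next
      fix l
      assume *: "\<And>v. v \<in> Rn T \<Longrightarrow>
        l \<le> phi instance_problem v + ereal (1 / (2 * (1 / (2 * L))) * (norm (v - x))\<^sup>2)"
      have qX: "q \<in> X" using q by (simp add: is_prox_def)
      show "l \<le> ereal (Psi q + L * (norm (q - x))\<^sup>2)"
        using *[OF X_D(1)[OF qX]] qX L by (simp add: phi_def convex_indicator_def dom Phi_eq)
    qed
    with q show ?thesis by auto
  qed
  have pX: "p \<in> X" using p by (simp add: is_prox_def)
  have "gradient_in (Rn T) ?M x = (2 * L) *\<^sub>R (x - p)"
  proof (rule gradient_in_eqI[OF subspace_Rn X_D(1)[OF x]])
    show "(2 * L) *\<^sub>R (x - p) \<in> Rn T"
      using X_D(1)[OF x] X_D(1)[OF pX] by (intro subspace_scale subspace_diff subspace_Rn)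
    show "(?M has_derivative (\<lambda>h. (2 * L) *\<^sub>R (x - p) \<bullet> h)) (at x within Rn T)"
      using envelope_has_derivative[of ?M x p "Rn T"] M p by (simp add: L_def)
  qed
  moreover have "dimx instance_problem = T" by (simp add: instance_problem_def)
  ultimately show ?thesis
    using L by (simp add: stationarity_measure_def L_def)
qed

text \<open>If every coordinate of \<open>p\<close> has reached \<open>s\<close>, then
  \<open>p\<close> is far from \<open>x\<close> in the last one. Otherwise the first coordinate of
  \<open>p\<close> below \<open>s\<close> can be raised within \<open>X\<close>; \<open>Psi\<close>
  has slope at most \<open>- \<kappa> * s\<close> in this direction, so optimality of
  \<open>p\<close> forces the proximal term to compensate.\<close>

lemma prox_far:
  assumes x: "x \<in> X" "coord x (T - 1) = 0" and p: "is_prox X Psi (64 * \<kappa>) x p"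
  shows "\<kappa> * s \<le> 2 * (64 * \<kappa>) * norm (x - p)"
proof -
  have pX: "p \<in> X" using p by (simp add: is_prox_def)
  show ?thesis
  proof (cases "\<exists>k<T. coord p k < s")
    case False
    then have "s \<le> coord p (T - 1)" using T_pos by (metis diff_less not_less zero_less_one)
    also have "\<dots> \<le> \<bar>coord (x - p) (T - 1)\<bar>" using x(2) by (simp add: coord_simps)
    also have "\<dots> \<le> norm (x - p)" by (rule abs_coord_le_norm)
    finally have "\<kappa> * s \<le> \<kappa> * norm (x - p)" using \<kappa>_pos by simp
    also have "\<dots> \<le> 128 * (\<kappa> * norm (x - p))" using \<kappa>_pos by simp
    finally show ?thesis by simp
  next
    case True
    define k where "k = (LEAST k. k < T \<and> coord p k < s)"
    have k: "k < T" "coord p k < s" using LeastI_ex[OF True] by (simp_all add: k_def)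
    have before: "coord p j \<ge> s" if "j < k" for j
      using not_less_Least[of j "\<lambda>k. k < T \<and> coord p k < s"] that k(1) by (auto simp: k_def)
    have ak: "prev s p k = s"
    proof (cases k)
      case (Suc j)
      with before[of j] X_D(5)[OF pX, of j] show ?thesis by simp
    qed simp
    define e where "e = Poly_Mapping.single k (1 :: real)"
    define f where "f t = p + t *\<^sub>R e" for t
    have ce: "coord (f t) j = coord p j + t * of_bool (j = k)" for t j
      by (simp add: f_def e_def coord_simps lookup_single when_def)
    have pe: "prev s (f t) j = prev s p j + t * of_bool (j = Suc k)" for t j
      by (cases j) (simp_all add: ce)
    \<comment> \<open>\<open>A\<close> is the derivative of a link in its far coordinate and
      \<open>B\<close> in its near one: raising coordinate \<open>k\<close> acts on link
      \<open>k\<close> through \<open>A\<close> and on link \<open>Suc k\<close>, if present,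
      through \<open>B\<close>.\<close>
    define A B where "A j = - 5 * coord p j + (- (2 * coord p j * theta p j)
        - prev s p j * (prev s p j * (prev s p j - coord p j))) / s\<^sup>2"
      and "B j = (2 * prev s p j * theta p j
        + (2 * prev s p j - coord p j) * (prev s p j * (prev s p j - coord p j))) / s\<^sup>2" for j
    have poly: "((\<lambda>t. - (5 / 2) * (b + t * u)\<^sup>2 + (((a + t * v)\<^sup>2 - (b + t * u)\<^sup>2)\<^sup>2
          + ((a + t * v) * (a + t * v - (b + t * u)))\<^sup>2) * r) has_real_derivative
        u * (- 5 * b + (- (2 * b * (a\<^sup>2 - b\<^sup>2)) - a * (a * (a - b))) * (2 * r))
        + v * ((2 * a * (a\<^sup>2 - b\<^sup>2) + (2 * a - b) * (a * (a - b))) * (2 * r))) (at 0)"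
      for a b u v r :: real
      by (rule DERIV_cong, (rule derivative_intros)+) (simp add: algebra_simps power2_eq_square)
    have "((\<lambda>t. link (f t) j) has_real_derivative of_bool (j = k) * A j + of_bool (j = Suc k) * B j) (at 0)" for j
      using poly[of "coord p j" "of_bool (j = k)" "prev s p j" "of_bool (j = Suc k)" "1 / (2 * s\<^sup>2)"]
      unfolding link_def theta_def ce pe A_def B_def by simp
    then have "((\<lambda>t. Psi (f t)) has_real_derivative
        \<kappa> * (\<Sum>j<T. of_bool (j = k) * A j + of_bool (j = Suc k) * B j)) (at 0)"
      unfolding Psi_def by (intro DERIV_cmult DERIV_sum)
    moreover have "(\<Sum>j<T. of_bool (j = k) * A j + of_bool (j = Suc k) * B j)
        = A k + of_bool (Suc k < T) * B (Suc k)"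
    proof -
      have "(\<Sum>j<T. of_bool (j = l) * C j) = of_bool (l < T) * (C l :: real)" for l C
      proof -
        have "(\<Sum>j<T. of_bool (j = l) * C j) = (\<Sum>j<T. if j = l then C j else 0)"
          by (intro sum.cong) auto
        then show ?thesis by simp
      qed
      then show ?thesis using k by (simp add: sum.distrib)
    qed
    ultimately have D1: "((\<lambda>t. Psi (f t)) has_real_derivative
        \<kappa> * (A k + of_bool (Suc k < T) * B (Suc k))) (at 0)" by simp
    have "(norm (f t - x))\<^sup>2 = (norm (p - x))\<^sup>2 + 2 * t * coord (p - x) k + t\<^sup>2" for t
    proof -
      have ev: "e \<bullet> v = coord v k" "v \<bullet> e = coord v k" "coord e k = 1" for v
        by (simp_all add: coord_eq_inner[symmetric] e_def inner_commute[of v])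
      show ?thesis
        unfolding f_def power2_norm_eq_inner
        by (simp add: inner_diff_left inner_diff_right inner_add_left inner_add_right ev
            inner_commute[of x p] coord_simps power2_eq_square algebra_simps)
    qed
    moreover have "((\<lambda>t. (norm (p - x))\<^sup>2 + 2 * t * coord (p - x) k + t\<^sup>2) has_real_derivative
        2 * coord (p - x) k) (at 0)"
      by (auto intro!: derivative_eq_intros)
    ultimately have D2: "((\<lambda>t. (norm (f t - x))\<^sup>2) has_real_derivative 2 * coord (p - x) k) (at 0)"
      by simp
    define g where "g t = Psi (f t) + 64 * \<kappa> * (norm (f t - x))\<^sup>2" for t
    define D where "D = \<kappa> * (A k + of_bool (Suc k < T) * B (Suc k)) + 64 * \<kappa> * (2 * coord (p - x) k)"
    have Dg: "(g has_real_derivative D) (at 0)"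
      unfolding g_def D_def by (intro DERIV_add DERIV_cmult D1 D2)
    have "D \<ge> 0"
    proof (rule ccontr)
      assume "\<not> D \<ge> 0"
      then obtain d where d: "d > 0" "\<And>h. 0 < h \<Longrightarrow> h < d \<Longrightarrow> g (0 + h) < g 0"
        using DERIV_neg_dec_right[OF Dg] by force
      \<comment> \<open>Small enough for the derivative to decide the sign and for coordinate
        \<open>k\<close> to stay below its predecessor \<open>s\<close>; raising it only relaxes the
        next constraint.\<close>
      define t where "t = min (d / 2) (s - coord p k)"
      have t: "0 < t" "t < d" "t \<le> s - coord p k" using d(1) k(2) by (auto simp: t_def)
      have "f t \<in> X"
        unfolding X_def
      proof (intro CollectI conjI allI impI)
        have "e \<in> Rn T" using k(1) by (auto simp: Rn_iff e_def lookup_single when_def)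
        then show "f t \<in> Rn T"
          unfolding f_def using X_D(1)[OF pX] by (intro subspace_add subspace_scale subspace_Rn)
        fix j
        show "0 \<le> coord (f t) j" using X_D(2)[OF pX, of j] t by (simp add: ce)
        show "coord (f t) j \<le> prev s (f t) j"
          using X_D(3)[OF pX, of j] t ak by (auto simp: ce pe)
      qed
      then have "g 0 \<le> g t" using p by (simp add: g_def f_def is_prox_def)
      with d(2)[of t] t show False by simp
    qed
    \<comment> \<open>Of the slope \<open>- 5 * coord p k\<close>, one part turns
      \<open>- (s - coord p k)\<close> into \<open>- s\<close>; the other four offset the slope of
      the next link, at most \<open>4 * coord p k\<close>. This explains the coefficient
      \<open>5 / 2\<close> in \<open>block\<close>.\<close>
    moreover have "A k \<le> - s - 4 * coord p k"
    proof -
      have th: "0 \<le> 2 * coord p k * theta p k" using X_D(2)[OF pX] theta_eta(1)[OF pX] by simp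
      have "A k = - 5 * coord p k - 2 * coord p k * theta p k / s\<^sup>2 - (s - coord p k)"
        unfolding A_def ak using s_pos by (simp add: field_simps power2_eq_square)
      moreover have "0 \<le> 2 * coord p k * theta p k / s\<^sup>2" using th by simp
      ultimately show ?thesis by linarith
    qed
    moreover have "of_bool (Suc k < T) * B (Suc k) \<le> 4 * coord p k"
    proof -
      define b c where "b = coord p k" and "c = coord p (Suc k)"
      have bc: "0 \<le> c" "c \<le> b" "b \<le> s" "0 \<le> b"
        using X_D(2,5)[OF pX, of k] X_D(2,3)[OF pX, of "Suc k"] by (simp_all add: b_def c_def)
      have b2: "b\<^sup>2 \<le> s\<^sup>2" using bc by (intro power_mono)
      have "b\<^sup>2 - c\<^sup>2 \<le> s\<^sup>2" using b2 zero_le_power2[of c] by linarith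
      then have "2 * b * (b\<^sup>2 - c\<^sup>2) \<le> 2 * b * s\<^sup>2" using bc(4) by (intro mult_left_mono) auto
      moreover have "(2 * b - c) * (b * (b - c)) \<le> 2 * b * s\<^sup>2"
      proof (rule mult_mono)
        have "b * (b - c) \<le> b * b" using bc by (intro mult_left_mono) auto
        then show "b * (b - c) \<le> s\<^sup>2" using b2 by (simp add: power2_eq_square)
      qed (use bc in auto)
      ultimately have "B (Suc k) \<le> 4 * b"
        using s_pos unfolding B_def theta_def prev_simps b_def[symmetric] c_def[symmetric]
        by (simp add: divide_le_eq)
      then show ?thesis using bc by (auto simp: b_def)
    qed
    ultimately have "0 \<le> \<kappa> * (- s) + 64 * \<kappa> * (2 * coord (p - x) k)"
    proof -
      assume *: "A k \<le> - s - 4 * coord p k" "of_bool (Suc k < T) * B (Suc k) \<le> 4 * coord p k" "0 \<le> D"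
      have "A k + of_bool (Suc k < T) * B (Suc k) \<le> - s" using * by linarith
      then have "\<kappa> * (A k + of_bool (Suc k < T) * B (Suc k)) \<le> \<kappa> * (- s)"
        using \<kappa>_pos by (intro mult_left_mono) auto
      with *(3) show ?thesis unfolding D_def by linarith
    qed
    moreover have "64 * \<kappa> * (2 * coord (p - x) k) \<le> 64 * \<kappa> * (2 * norm (x - p))"
      using abs_coord_le_norm[of "p - x" k] \<kappa>_pos
      by (intro mult_left_mono) (auto simp: norm_minus_commute)
    ultimately show ?thesis by simp
  qed
qed

lemma stationarity_lower_bound:
  assumes "x \<in> X" "coord x (T - 1) = 0"
  shows "\<kappa> * s \<le> stationarity_measure (64 * \<kappa>) instance_problem x"
proof -
  obtain p where p: "is_prox X Psi (64 * \<kappa>) x p" using prox_exists by blast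
  show ?thesis using prox_far[OF assms p] stationarity_measure_eq[OF assms(1) p] by simp
qed

section \<open>Membership in the function class\<close>

lemma G_Rn: "G z \<in> Rn T \<times> Rn (T * m)"
proof -
  have "rvec_of T g \<in> Rn T" "rvec_of (T * m) g \<in> Rn (T * m)" for g by (simp_all only: rvec_of_in_Rn)
  then show ?thesis
    unfolding G_def by (auto simp del: mult_Suc_right intro!: subspace_scale subspace_Rn)
qed

text \<open>At \<open>x = 0\<close> only the first link has a nonzero value, so the maximum is
  \<open>\<kappa> * s^2\<close>; at \<open>y = 0\<close> each link contributes at least
  \<open>- (5 / 2) * \<kappa> * s^2\<close>. The gap is thus at most
  \<open>7 / 2 * \<kappa> * s^2 * T\<close>. The diameter is at most twice the radius
  \<open>3 * n * s\<close>.\<close>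

lemma NCC_pd_instance:
  assumes G0: "4 * \<kappa> * s\<^sup>2 * T \<le> G0" and DY: "6 * n * s \<le> DY"
  shows "NCC_pd (64 * \<kappa>) G0 DY instance_problem"
proof -
  have lip: "(64 * \<kappa>)-lipschitz_on (X \<times> Y) G"
    by (rule lipschitz_on_mono[OF G_Lipschitz]) (use \<kappa>_pos in auto)
  have bounded: "bounded Y" using compact_Y by (rule compact_imp_bounded)
  have diam: "diameter Y \<le> DY"
  proof (rule diameter_le)
    show "Y \<noteq> {} \<or> 0 \<le> DY" using zero_in_Y by blast
    fix x y assume "x \<in> Y" "y \<in> Y"
    then have "norm (x - y) \<le> 3 * n * s + 3 * n * s"
      using Y_D(4) norm_triangle_ineq4[of x y] by (meson add_mono order_trans)
    then show "norm (x - y) \<le> DY" using DY by linarith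
  qed
  have low: "- (5 / 2) * \<kappa> * s\<^sup>2 * T \<le> F (x, 0)" if x: "x \<in> X" for x
  proof -
    have "spring 0 j = 0" for j using \<delta>_pos by (simp add: spring_def huber_def)
    moreover have "(\<Sum>k<T. - (5 / 2) * s\<^sup>2) \<le> (\<Sum>k<T. block (x, 0) k)"
    proof (rule sum_mono)
      fix k
      have "(coord x k)\<^sup>2 \<le> s\<^sup>2" using X_D[OF x] by (intro power_mono)
      then show "- (5 / 2) * s\<^sup>2 \<le> block (x, 0) k" by (simp add: block_def head_def tail_def)
    qed
    moreover have "F (x, 0) = \<kappa> * (\<Sum>k<T. block (x, 0) k)"
      if "\<And>j. spring 0 j = 0" using that by (simp add: F_def)
    ultimately have "\<kappa> * (\<Sum>k<T. - (5 / 2) * s\<^sup>2) \<le> F (x, 0)"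
      using \<kappa>_pos by (simp only: mult_left_mono less_imp_le)
    then show ?thesis by (simp add: mult_ac)
  qed
  have bdd: "bdd_below ((\<lambda>x. F (x, 0)) ` X)"
    using low by (intro bdd_belowI2)
  have inf: "- (5 / 2) * \<kappa> * s\<^sup>2 * T \<le> (INF x\<in>X. F (x, 0))"
    using low zero_in_X by (intro cINF_greatest) auto
  have "(SUP y\<in>Y. F (0, y)) = Psi 0"
    using Phi_eq[OF zero_in_X] by (simp add: Phi_def instance_problem_def)
  also have "\<dots> = \<kappa> * s\<^sup>2"
  proof -
    have "link 0 k = of_bool (k = 0) * s\<^sup>2" for k
      using s_pos by (cases k) (simp_all add: link_def theta_def power2_eq_square field_simps)
    moreover have "(\<Sum>k<T. of_bool (k = 0) * s\<^sup>2) = (\<Sum>k<T. if k = 0 then s\<^sup>2 else 0)"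
      by (intro sum.cong) auto
    ultimately show ?thesis using T_pos by (simp add: Psi_def)
  qed
  also have "\<dots> \<le> \<kappa> * s\<^sup>2 * T"
    using mult_left_mono[of 1 "real T" "\<kappa> * s\<^sup>2"] T_pos \<kappa>_pos by simp
  finally have sup: "(SUP y\<in>Y. F (0, y)) \<le> \<kappa> * s\<^sup>2 * T" .
  have "0 \<le> \<kappa> * s\<^sup>2 * T" using \<kappa>_pos by simp
  then have gap: "(SUP y\<in>Y. F (0, y)) - (INF x\<in>X. F (x, 0)) \<le> G0"
    using sup inf G0 by argo
  show ?thesis
    unfolding NCC_pd_def instance_problem_def problem.simps
    using X_D(1) Y_D(1) closed_X closed_Y convex_X convex_Y zero_in_X zero_in_Y G_Rn
      F_has_derivative lip lipschitz_on_continuous_on[OF lip] F_concave bounded diam bdd gap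
    by (auto simp del: mult_Suc_right)
qed

section \<open>Chain structure of the gradient\<close>

definition reached :: "rvec \<times> rvec \<Rightarrow> nat \<Rightarrow> bool" where
  "reached z j \<longleftrightarrow> z \<in> Rn (j div m) \<times> Rn j"

lemma reached_top: "z \<in> X \<times> Y \<Longrightarrow> reached z (T * m)"
  using X_D(1) Y_D(1) by (auto simp: reached_def simp del: mult_Suc_right)

text \<open>Being reached at \<open>j\<close> means support in the first \<open>j\<close> dual
  coordinates and in those primal coordinates whose whole block lies below \<open>j\<close>. The
  gradient then has at most one new coordinate, the dual coordinate \<open>j\<close>, and its entry
  there is \<open>\<kappa>\<close> times a head force or an incoming tension, both bounded by
  \<open>\<delta>\<close>.\<close>

lemma reached_gradient:
  assumes z: "z \<in> X \<times> Y" and r: "reached z j"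
  shows "fst (G z) \<in> Rn (j div m)" "snd (G z) \<in> Rn (Suc j)" "\<bar>coord (snd (G z)) j\<bar> \<le> \<kappa> * \<delta>"
proof -
  have x0: "coord (fst z) k = 0" if "j < Suc k * m" for k
  proof -
    have "j div m < Suc k" using that by (simp only: less_mult_imp_div_less)
    then show ?thesis using r by (auto simp: reached_def Rn_iff)
  qed
  have y0: "coord (snd z) i = 0" if "j \<le> i" for i
    using r that by (auto simp: reached_def Rn_iff)
  have t0: "tension (snd z) i = 0" if "j \<le> i" for i
    using that \<delta>_pos by (simp add: tension_def y0 clip_0)
  have tb: "\<bar>tension (snd z) i\<bar> \<le> \<delta>" for i
    using abs_clip[of \<delta>] \<delta>_pos by (auto simp: tension_def)
  \<comment> \<open>An unopened primal coordinate could be moved only through the tail of its own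
    block, which is still zero.\<close>
  have "gx z k = 0" if "j div m \<le> k" for k
  proof -
    have "j < Suc k * m" using that by (subst div_less_iff_less_mult[symmetric]) auto
    moreover from this have "j \<le> k * m + n" "j < Suc (Suc k) * m" by simp_all
    ultimately show ?thesis
      using x0[of k] x0[of "Suc k"] y0[of "k * m + n"] by (simp add: gx_def tail_def)
  qed
  then show "fst (G z) \<in> Rn (j div m)" by (simp add: G_def Rn_iff coord_simps coord_rvec_of)
  have div: "i div m * m + i mod m = i" for i by (rule div_mult_mod_eq)
  have et: "eta (fst z) (i div m) = 0" if "j \<le> i" "i mod m = n" for i
  proof -
    have "i < Suc (i div m) * m" using div[of i] that by simp
    then show ?thesis using x0[of "i div m"] that(1) by (simp add: eta_def)
  qed
  have "gy z i = 0" if i: "Suc j \<le> i" for i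
  proof -
    have "theta (fst z) (i div m) = 0" if "i mod m = 0"
    proof -
      have im: "i div m * m = i" using div[of i] that by simp
      then obtain k where k: "i div m = Suc k" using i by (cases "i div m") auto
      then have "j < Suc k * m" using im i by simp
      moreover then have "j < Suc (Suc k) * m" by simp
      ultimately show ?thesis unfolding theta_def k using x0[of k] x0[of "Suc k"] by simp
    qed
    moreover have "(case i of 0 \<Rightarrow> 0 | Suc l \<Rightarrow> tension (snd z) l) = 0"
      using i t0 by (cases i) auto
    ultimately show ?thesis
      using et[of i] y0[of i] t0[of i] i n_pos by (cases "i mod m = 0") (simp_all add: gy_def)
  qed
  then show "snd (G z) \<in> Rn (Suc j)" by (simp add: G_def Rn_iff coord_simps coord_rvec_of)
  have "\<bar>gy z j\<bar> \<le> \<delta>"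
  proof (cases "j mod m = 0")
    case True
    \<comment> \<open>No spring enters the first coordinate of a block.\<close>
    have "(case j of 0 \<Rightarrow> 0 | Suc l \<Rightarrow> tension (snd z) l) = 0"
    proof (cases j)
      case (Suc l)
      have "l mod m = n"
        using True Suc by (metis mod_Suc nat.distinct(1) nat.inject)
      then show ?thesis using Suc by (simp add: tension_def)
    qed simp
    then have "gy z j = w * theta (fst z) (j div m)"
      using True n_pos t0[of j] by (simp add: gy_def)
    then show ?thesis using theta_force[of "fst z"] z by auto
  next
    case False
    then have "gy z j = (case j of 0 \<Rightarrow> 0 | Suc i \<Rightarrow> tension (snd z) i)"
      using t0[of j] y0[of j] et[of j] by (simp add: gy_def)
    then show ?thesis using tb \<delta>_pos by (simp split: nat.split)
  qed
  then have "\<kappa> * \<bar>gy z j\<bar> \<le> \<kappa> * \<delta>" using \<kappa>_pos by simp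
  then show "\<bar>coord (snd (G z)) j\<bar> \<le> \<kappa> * \<delta>"
    using \<kappa>_pos \<delta>_pos by (auto simp: G_def coord_simps coord_rvec_of abs_mult)
qed

end

section \<open>The stochastic oracle\<close>

definition bernoulli_law :: "real \<Rightarrow> real measure" where
  "bernoulli_law p = distr (measure_pmf (bernoulli_pmf p)) borel of_bool"

lemma sets_bernoulli_law [simp, measurable_cong]: "sets (bernoulli_law p) = sets borel"
  by (simp add: bernoulli_law_def)

lemma prob_space_bernoulli_law: "prob_space (bernoulli_law p)"
  unfolding bernoulli_law_def by (rule measure_pmf.prob_space_distr) simp

lemma nn_integral_bernoulli_law:
  assumes "f \<in> borel_measurable borel" "0 \<le> p" "p \<le> 1"
  shows "(\<integral>\<^sup>+ x. f x \<partial>bernoulli_law p) = f 1 * ennreal p + f 0 * ennreal (1 - p)"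
  using assms by (simp add: bernoulli_law_def nn_integral_distr)

lemma has_bochner_integral_bernoulli_law:
  fixes f :: "real \<Rightarrow> real"
  assumes "f \<in> borel_measurable borel" "0 \<le> p" "p \<le> 1"
  shows "has_bochner_integral (bernoulli_law p) f (f 1 * p + f 0 * (1 - p))"
proof -
  have "has_bochner_integral (measure_pmf (bernoulli_pmf p)) (\<lambda>b. f (of_bool b)) (f 1 * p + f 0 * (1 - p))"
    using assms integrable_measure_pmf_finite[of "bernoulli_pmf p" "\<lambda>b. f (of_bool b)"]
    by (simp add: has_bochner_integral_iff)
  then show ?thesis
    unfolding bernoulli_law_def using assms(1) by (intro has_bochner_integral_distr) auto
qed

text \<open>Multiplying a number by a Bernoulli variable of parameter \<open>p\<close>, divided by
  \<open>p\<close>, keeps its mean and adds variance \<open>(1 - p) / p\<close> times its square;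
  \<open>\<kappa> * \<delta>\<close> bounds the coordinate treated this way.\<close>

locale hard_oracle = hard_instance +
  fixes p \<sigma> :: real
  assumes p: "0 < p" "p \<le> 1" and noise: "(\<kappa> * \<delta>)\<^sup>2 * ((1 - p) / p) \<le> \<sigma>\<^sup>2"
begin

definition progress :: "rvec \<times> rvec \<Rightarrow> nat" where
  "progress z = (LEAST j. reached z j)"

text \<open>Only the single dual coordinate that a query can newly reveal is randomised.\<close>

definition masked :: "nat \<Rightarrow> real \<Rightarrow> rvec \<times> rvec \<Rightarrow> rvec \<times> rvec" where
  "masked j c z = G z + ((c - 1) * coord (snd (G z)) j) *\<^sub>R (0, Poly_Mapping.single j 1)"

text \<open>Every seed other than 1 counts as a failure, so the progress bounds hold for all real
  seed sequences.\<close>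

definition noisy_oracle :: oracle_model where
  "noisy_oracle = \<lparr>seed_law = bernoulli_law p,
     estimate = (\<lambda>z s. masked (progress z) (if s = 1 then 1 / p else 0) z)\<rparr>"

lemma progress:
  assumes "z \<in> X \<times> Y"
  shows "reached z (progress z)" "reached z j \<Longrightarrow> progress z \<le> j"
  unfolding progress_def using LeastI[of "reached z", OF reached_top[OF assms]] Least_le by auto

lemma fst_masked: "fst (masked j c z) = fst (G z)"
  by (simp add: masked_def)

lemma coord_masked:
  "coord (snd (masked j c z)) i = (if i = j then c else 1) * coord (snd (G z)) i"
  by (simp add: masked_def coord_simps lookup_single when_def algebra_simps)

lemma masked_Rn: "masked j c z \<in> Rn T \<times> Rn (T * m)"
  using G_Rn[of z] by (auto simp: mem_Times_iff fst_masked coord_masked Rn_iff simp del: mult_Suc_right)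

lemma norm_masked: "norm (masked j c z - G z) = \<bar>(c - 1) * coord (snd (G z)) j\<bar>"
proof -
  have "norm (Poly_Mapping.single j (1::real)) = 1"
    by (simp add: norm_eq_sqrt_inner coord_eq_inner[symmetric])
  then show ?thesis by (simp add: masked_def norm_Pair)
qed

lemma continuous_on_masked: "continuous_on (X \<times> Y) (masked j c)"
  unfolding masked_def
  by (intro continuous_intros lipschitz_on_continuous_on[OF G_Lipschitz])

lemma measurable_reached: "Measurable.pred borel (\<lambda>z. reached z j)"
proof -
  have "closed {z. reached z j}"
    using closed_Times[OF closed_Rn closed_Rn] by (simp add: reached_def del: mult_Suc_right)
  then show ?thesis by (simp add: pred_def borel_closed)
qed

lemma unbiased_noisy_oracle: "unbiased_oracle instance_problem (\<sigma>\<^sup>2) noisy_oracle"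
proof -
  let ?c = "\<lambda>s :: real. if s = 1 then 1 / p else 0"
  let ?D = "restrict_space borel (X \<times> Y) :: (rvec \<times> rvec) measure"
  have prog: "progress \<in> measurable ?D (count_space UNIV)"
    unfolding progress_def
    by (intro measurable_Least measurable_restrict_space1 measurable_reached)
  have meas: "masked j c \<in> borel_measurable ?D" for j c
    by (intro borel_measurable_continuous_on_restrict continuous_on_masked)
  have "(\<lambda>u. masked j (?c (snd u)) (fst u)) \<in> borel_measurable (?D \<Otimes>\<^sub>M bernoulli_law p)" for j
  proof -
    have "(\<lambda>u. if snd u = 1 then masked j (1 / p) (fst u) else masked j 0 (fst u))
        \<in> borel_measurable (?D \<Otimes>\<^sub>M bernoulli_law p)"
    proof (rule measurable_If)
      show "(\<lambda>u. masked j c (fst u)) \<in> borel_measurable (?D \<Otimes>\<^sub>M bernoulli_law p)" for c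
        by (rule measurable_compose[OF measurable_fst meas])
      show "(\<lambda>u. masked j c (fst u)) \<in> borel_measurable (?D \<Otimes>\<^sub>M bernoulli_law p)" for c
        by (rule measurable_compose[OF measurable_fst meas])
      show "{u \<in> space (?D \<Otimes>\<^sub>M bernoulli_law p). snd u = 1} \<in> sets (?D \<Otimes>\<^sub>M bernoulli_law p)"
        by measurable
    qed
    then show ?thesis by (simp add: if_distrib[of "\<lambda>c. masked j c _"] cong: if_cong)
  qed
  \<comment> \<open>For a fixed masked coordinate the estimate is measurable, and the index of that
    coordinate is a measurable function of the query with countably many values.\<close>
  from measurable_compose_countable[OF this measurable_compose[OF measurable_fst prog]]
  have measurable: "(\<lambda>(z, s). masked (progress z) (?c s) z)
      \<in> borel_measurable (?D \<Otimes>\<^sub>M bernoulli_law p)"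
    by (simp add: case_prod_unfold)
  have mean: "has_bochner_integral (bernoulli_law p) (\<lambda>s. f (?c s)) (f (1 / p) * p + f 0 * (1 - p))"
    for f :: "real \<Rightarrow> real"
    using has_bochner_integral_bernoulli_law[of "\<lambda>s. f (?c s)" p] p
    by (simp add: if_distrib[of f] cong: if_cong)
  have mean_x: "has_bochner_integral (bernoulli_law p) (\<lambda>s. coord (fst (masked j (?c s) z)) i)
      (coord (fst (G z)) i)" for j i z
    using mean[of "\<lambda>c. coord (fst (masked j c z)) i"] by (simp add: fst_masked algebra_simps)
  have mean_y: "has_bochner_integral (bernoulli_law p) (\<lambda>s. coord (snd (masked j (?c s) z)) i)
      (coord (snd (G z)) i)" for j i z
    using mean[of "\<lambda>c. coord (snd (masked j c z)) i"] p
    by (cases "i = j") (simp_all add: coord_masked algebra_simps)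
  have var: "(\<integral>\<^sup>+ s. ennreal ((norm (masked (progress z) (?c s) z - G z))\<^sup>2) \<partial>bernoulli_law p) \<le> ennreal (\<sigma>\<^sup>2)"
    if z: "z \<in> X \<times> Y" for z
  proof -
    define g where "g = coord (snd (G z)) (progress z)"
    have "\<bar>g\<bar> \<le> \<kappa> * \<delta>" unfolding g_def using progress(1)[OF z] z by (intro reached_gradient)
    then have g2: "g\<^sup>2 \<le> (\<kappa> * \<delta>)\<^sup>2" using power_mono[of "\<bar>g\<bar>" "\<kappa> * \<delta>" 2] by simp
    have "(\<integral>\<^sup>+ s. ennreal ((norm (masked (progress z) (?c s) z - G z))\<^sup>2) \<partial>bernoulli_law p)
        = ennreal (((1 / p - 1) * g)\<^sup>2) * ennreal p + ennreal (g\<^sup>2) * ennreal (1 - p)"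
      using p by (subst nn_integral_bernoulli_law) (simp_all add: norm_masked g_def)
    also have "\<dots> = ennreal (((1 / p - 1) * g)\<^sup>2 * p + g\<^sup>2 * (1 - p))"
      using p by (simp add: ennreal_mult ennreal_plus)
    also have "((1 / p - 1) * g)\<^sup>2 * p + g\<^sup>2 * (1 - p) = g\<^sup>2 * ((1 - p) / p)"
      using p by (simp add: field_simps power2_eq_square)
    also have "\<dots> \<le> (\<kappa> * \<delta>)\<^sup>2 * ((1 - p) / p)"
      using p g2 by (intro mult_right_mono) auto
    also have "\<dots> \<le> \<sigma>\<^sup>2" by (rule noise)
    finally show ?thesis by (simp add: ennreal_leI)
  qed
  show ?thesis
    unfolding unbiased_oracle_def noisy_oracle_def instance_problem_def
      problem.simps oracle_model.simps
    using prob_space_bernoulli_law masked_Rn measurable mean_x mean_y var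
    by (auto simp del: mult_Suc_right)
qed

section \<open>Progress of a zero-respecting algorithm\<close>

definition heads :: "(nat \<Rightarrow> real) \<Rightarrow> nat \<Rightarrow> nat" where
  "heads \<xi> t = card {i. i < t \<and> \<xi> i = 1}"

lemma heads_Suc: "heads \<xi> (Suc t) = heads \<xi> t + (if \<xi> t = 1 then 1 else 0)"
proof -
  have "{i. i < Suc t \<and> \<xi> i = 1} = (if \<xi> t = 1 then insert t {i. i < t \<and> \<xi> i = 1} else {i. i < t \<and> \<xi> i = 1})"
    by (auto simp: less_Suc_eq)
  then show ?thesis by (simp add: heads_def)
qed

context
  fixes A :: algorithm and r :: real and \<xi> :: "nat \<Rightarrow> real"
  assumes zr: "zero_respecting instance_problem noisy_oracle A"
begin

private abbreviation "it \<equiv> iterate instance_problem noisy_oracle A r \<xi>"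
private abbreviation "rx \<equiv> revealed_x instance_problem noisy_oracle A r \<xi>"
private abbreviation "ry \<equiv> revealed_y instance_problem noisy_oracle A r \<xi>"

lemma revealed_Suc:
  "rx (Suc t) = rx t \<union> supp (fst (it t)) \<union> supp (fst (estimate noisy_oracle (it t) (\<xi> t)))"
  "ry (Suc t) = ry t \<union> supp (snd (it t)) \<union> supp (snd (estimate noisy_oracle (it t) (\<xi> t)))"
  by (auto simp: revealed_x_def revealed_y_def Let_def less_Suc_eq)

lemma proj_X: "proj X u \<in> X" and proj_Y: "proj Y u \<in> Y"
  using proj_closest(1)[OF compact_X] proj_closest(1)[OF compact_Y] zero_in_X zero_in_Y by auto

lemma supp_proj_X: "supp u \<subseteq> {..<j} \<Longrightarrow> proj X u \<in> Rn j"
  using supp_proj[OF compact_X _ trunc_X] zero_in_X unfolding Rn_def by blast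

lemma supp_proj_Y: "supp u \<subseteq> {..<j} \<Longrightarrow> proj Y u \<in> Rn j"
  using supp_proj[OF compact_Y _ trunc_Y] zero_in_Y unfolding Rn_def by blast

text \<open>A failure erases the only coordinate that a query could newly reveal, and a success
  opens at most one. Projections preserve the supports, so the next query satisfies the invariant
  again.\<close>

lemma revealed_bound:
  "rx t \<subseteq> {..<heads \<xi> t div m} \<and> ry t \<subseteq> {..<heads \<xi> t}
     \<and> it t \<in> X \<times> Y \<and> reached (it t) (heads \<xi> t)"
proof (induction t)
  case 0
  have "it 0 = (0, 0)" using zr by (simp add: zero_respecting_def)
  then show ?case
    using zero_in_X zero_in_Y by (simp add: revealed_x_def revealed_y_def reached_def Rn_iff)
next
  case (Suc t)
  define j where "j = heads \<xi> t"
  define e where "e = estimate noisy_oracle (it t) (\<xi> t)"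
  have j: "heads \<xi> (Suc t) = (if \<xi> t = 1 then Suc j else j)" by (simp add: heads_Suc j_def)
  have z: "it t \<in> X \<times> Y" "reached (it t) j" using Suc by (simp_all add: j_def)
  have e: "e = masked (progress (it t)) (if \<xi> t = 1 then 1 / p else 0) (it t)"
    by (simp add: e_def noisy_oracle_def)
  have ex: "fst e \<in> Rn (j div m)"
    unfolding e fst_masked using z by (intro reached_gradient)
  have ey: "snd e \<in> Rn (heads \<xi> (Suc t))"
  proof (cases "\<xi> t = 1")
    case True
    then show ?thesis
      using reached_gradient(2)[OF z] by (simp add: e j Rn_iff coord_masked)
  next
    case False
    \<comment> \<open>The masked coordinate is the frontier of the query itself, which may lie below
      \<open>j\<close>; in that case the whole gradient is already supported below
      \<open>j\<close>.\<close>
    have "progress (it t) \<le> j" using progress(2)[OF z(1)] z(2) by simp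
    moreover have "snd (G (it t)) \<in> Rn (Suc (progress (it t)))"
      using reached_gradient(2)[OF z(1) progress(1)[OF z(1)]] .
    ultimately show ?thesis
      using False by (auto simp: e j Rn_iff coord_masked)
  qed
  have le: "j \<le> heads \<xi> (Suc t)" "j div m \<le> heads \<xi> (Suc t) div m"
    using j by (auto intro: div_le_mono)
  have rx: "rx (Suc t) \<subseteq> {..<heads \<xi> (Suc t) div m}"
  proof -
    have "rx (Suc t) \<subseteq> {..<j div m}"
      using Suc z(2) ex unfolding revealed_Suc e_def[symmetric]
      by (simp add: j_def reached_def mem_Times_iff Rn_def del: mult_Suc_right)
    then show ?thesis using le by force
  qed
  have ry: "ry (Suc t) \<subseteq> {..<heads \<xi> (Suc t)}"
  proof -
    have "ry t \<union> supp (snd (it t)) \<subseteq> {..<j}"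
      using Suc z(2) by (simp add: j_def reached_def mem_Times_iff Rn_def)
    then show ?thesis using le ey unfolding revealed_Suc e_def[symmetric] Rn_def by force
  qed
  obtain u v where u: "supp u \<subseteq> rx (Suc t)" "fst (it (Suc t)) = proj X u"
    and v: "supp v \<subseteq> ry (Suc t)" "snd (it (Suc t)) = proj Y v"
    using zr unfolding zero_respecting_def instance_problem_def problem.simps by meson
  have "fst (it (Suc t)) \<in> X \<inter> Rn (heads \<xi> (Suc t) div m)" "snd (it (Suc t)) \<in> Y \<inter> Rn (heads \<xi> (Suc t))"
    unfolding u(2) v(2) using u(1) v(1) rx ry
    by (auto intro!: proj_X proj_Y supp_proj_X supp_proj_Y)
  with rx ry show ?case by (simp add: reached_def mem_Times_iff)
qed

lemma output_bound:
  "output_after instance_problem noisy_oracle A r \<xi> q \<in> X \<inter> Rn (heads \<xi> q div m)"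
proof -
  obtain u where u: "supp u \<subseteq> rx q" "output_after instance_problem noisy_oracle A r \<xi> q = proj X u"
    using zr unfolding zero_respecting_def instance_problem_def problem.simps by meson
  have "supp u \<subseteq> {..<heads \<xi> q div m}" using u(1) revealed_bound[of q] by blast
  then show ?thesis unfolding u(2) by (simp add: proj_X supp_proj_X)
qed

lemma output_far:
  assumes "heads \<xi> q < T * m"
  shows "\<kappa> * s \<le> stationarity_measure (64 * \<kappa>) instance_problem
    (output_after instance_problem noisy_oracle A r \<xi> q)"
proof (rule stationarity_lower_bound)
  have "heads \<xi> q div m < T" using assms by (simp only: less_mult_imp_div_less)
  then show "coord (output_after instance_problem noisy_oracle A r \<xi> q) (T - 1) = 0"
    using output_bound[of q] by (auto simp: Rn_iff)
qed (use output_bound[of q] in blast)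

end

section \<open>Expected progress and the query bound\<close>

lemma expected_heads:
  assumes "prob_space (coin_law A)"
  shows "integrable (run_space noisy_oracle A) (\<lambda>(r, \<xi>). real (heads \<xi> q))"
    and "(\<integral>(r, \<xi>). real (heads \<xi> q) \<partial>run_space noisy_oracle A) = q * p"
    and "prob_space (run_space noisy_oracle A)"
proof -
  interpret B: prob_space "bernoulli_law p" by (rule prob_space_bernoulli_law)
  interpret C: prob_space "coin_law A" by fact
  let ?S = "\<Pi>\<^sub>M t\<in>(UNIV :: nat set). bernoulli_law p"
  interpret P: prob_space ?S by (rule prob_space_PiM) (rule prob_space_bernoulli_law)
  interpret S: product_prob_space "\<lambda>_ :: nat. bernoulli_law p" UNIV
    by unfold_locales
  interpret CS: pair_prob_space "coin_law A" ?S ..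
  have run: "run_space noisy_oracle A = coin_law A \<Otimes>\<^sub>M ?S"
    by (simp add: run_space_def noisy_oracle_def)
  show "prob_space (run_space noisy_oracle A)"
    unfolding run by (rule CS.prob_space_axioms)
  \<comment> \<open>Linearity of expectation reduces the count to the marginal law of each single
    seed.\<close>
  have heads: "real (heads \<xi> q) = (\<Sum>t<q. of_bool (\<xi> t = 1))" for \<xi>
    by (simp add: heads_def sum.If_cases of_bool_def Int_def conj_commute lessThan_def)
  have hb: "has_bochner_integral (coin_law A \<Otimes>\<^sub>M ?S) (\<lambda>u. of_bool (snd u t = 1)) p" for t
  proof -
    have m: "(\<lambda>u. snd u t) \<in> measurable (coin_law A \<Otimes>\<^sub>M ?S) (bernoulli_law p)" by measurable
    have "distr (coin_law A \<Otimes>\<^sub>M ?S) (bernoulli_law p) (\<lambda>u. snd u t) = bernoulli_law p"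
    proof (rule measure_eqI)
      fix E assume "E \<in> sets (distr (coin_law A \<Otimes>\<^sub>M ?S) (bernoulli_law p) (\<lambda>u. snd u t))"
      then have E: "E \<in> sets (bernoulli_law p)" by simp
      have "(\<lambda>u. snd u t) -` E \<inter> space (coin_law A \<Otimes>\<^sub>M ?S)
          = space (coin_law A) \<times> {\<xi> \<in> space ?S. \<xi> t \<in> E}"
        by (auto simp: space_pair_measure)
      then have "emeasure (distr (coin_law A \<Otimes>\<^sub>M ?S) (bernoulli_law p) (\<lambda>u. snd u t)) E
          = emeasure (coin_law A \<Otimes>\<^sub>M ?S) (space (coin_law A) \<times> {\<xi> \<in> space ?S. \<xi> t \<in> E})"
        using m E by (simp add: emeasure_distr)
      also have "\<dots> = emeasure (coin_law A) (space (coin_law A)) * emeasure ?S {\<xi> \<in> space ?S. \<xi> t \<in> E}"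
        using E by (intro P.emeasure_pair_measure_Times) auto
      also have "\<dots> = emeasure (bernoulli_law p) E"
        using E S.emeasure_PiM_Collect_single[of t E] C.emeasure_space_1 by simp
      finally show "emeasure (distr (coin_law A \<Otimes>\<^sub>M ?S) (bernoulli_law p) (\<lambda>u. snd u t)) E
          = emeasure (bernoulli_law p) E" .
    qed simp
    then have "has_bochner_integral (distr (coin_law A \<Otimes>\<^sub>M ?S) (bernoulli_law p) (\<lambda>u. snd u t))
        (\<lambda>s. of_bool (s = 1)) p"
      using has_bochner_integral_bernoulli_law[of "\<lambda>s. of_bool (s = 1)" p] p by simp
    then show ?thesis
      using m by (simp add: has_bochner_integral_iff integrable_distr_eq integral_distr)
  qed
  have "has_bochner_integral (coin_law A \<Otimes>\<^sub>M ?S) (\<lambda>u. \<Sum>t<q. of_bool (snd u t = 1)) (\<Sum>t<q. p)"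
    by (intro has_bochner_integral_sum hb)
  then show "integrable (run_space noisy_oracle A) (\<lambda>(r, \<xi>). real (heads \<xi> q))"
    "(\<integral>(r, \<xi>). real (heads \<xi> q) \<partial>run_space noisy_oracle A) = q * p"
    by (simp_all add: run heads case_prod_unfold has_bochner_integral_iff)
qed

text \<open>Markov's inequality in affine form: the stationarity measure dominates an affine
  function of the number of successes, whose mean is \<open>q * p\<close>. Accuracy
  \<open>\<kappa> * s / 2\<close> forces this mean to be at least half of
  \<open>T * m\<close>.\<close>

lemma query_lower_bound:
  assumes A: "zero_respecting_algorithm instance_problem noisy_oracle A"
    and st: "expected_stationary (64 * \<kappa>) instance_problem noisy_oracle A (\<kappa> * s / 2) q"
  shows "T * m / (2 * p) \<le> q"
proof -
  have zr: "zero_respecting instance_problem noisy_oracle A" and C: "prob_space (coin_law A)"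
    using A by (simp_all add: zero_respecting_algorithm_def)
  let ?R = "run_space noisy_oracle A"
  interpret R: prob_space ?R by (rule expected_heads(3)[OF C])
  define N where "N = real (T * m)"
  have N: "N > 0" using T_pos by (simp add: N_def add_pos_nonneg)
  define f where "f u = \<kappa> * s * (1 - real (heads (snd u) q) / N)" for u :: "real \<times> (nat \<Rightarrow> real)"
  have int: "integrable ?R f" and val: "(\<integral>u. f u \<partial>?R) = \<kappa> * s * (1 - q * p / N)"
    using expected_heads(1,2)[OF C, of q]
    by (simp_all add: f_def[abs_def] case_prod_unfold R.prob_space)
  have far: "f u \<le> stationarity_measure (64 * \<kappa>) instance_problem
      (output_after instance_problem noisy_oracle A (fst u) (snd u) q)" for u
  proof (cases "heads (snd u) q < T * m")
    case True
    have "f u \<le> \<kappa> * s * 1"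
      unfolding f_def using \<kappa>_pos s_pos N by (intro mult_left_mono) auto
    with output_far[OF zr True, of "fst u"] show ?thesis by simp
  next
    case False
    then have "N \<le> real (heads (snd u) q)" unfolding N_def by (simp only: of_nat_le_iff not_less)
    then have "1 - real (heads (snd u) q) / N \<le> 0" using N by simp
    then have "f u \<le> 0"
      unfolding f_def using \<kappa>_pos s_pos by (intro mult_nonneg_nonpos) auto
    also have "0 \<le> stationarity_measure (64 * \<kappa>) instance_problem
      (output_after instance_problem noisy_oracle A (fst u) (snd u) q)"
      by (simp add: stationarity_measure_def)
    finally show ?thesis .
  qed
  \<comment> \<open>The positive part moves the bound into the nonnegative integral, where it is
    compared pointwise with the stationarity measure.\<close>
  have "(\<integral>u. f u \<partial>?R) \<le> (\<integral>u. max 0 (f u) \<partial>?R)"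
    using int by (intro integral_mono) auto
  then have "ennreal (\<integral>u. f u \<partial>?R) \<le> ennreal (\<integral>u. max 0 (f u) \<partial>?R)" by (rule ennreal_leI)
  also have "\<dots> = (\<integral>\<^sup>+ u. ennreal (max 0 (f u)) \<partial>?R)"
    using int by (intro nn_integral_eq_integral[symmetric]) auto
  also have "\<dots> \<le> (\<integral>\<^sup>+ u. ennreal (stationarity_measure (64 * \<kappa>) instance_problem
      (output_after instance_problem noisy_oracle A (fst u) (snd u) q)) \<partial>?R)"
    using far by (intro nn_integral_mono ennreal_leI) (simp add: stationarity_measure_def)
  also have "\<dots> \<le> ennreal (\<kappa> * s / 2)"
    using st by (simp add: expected_stationary_def case_prod_unfold)
  finally have "\<kappa> * s * (1 - q * p / N) \<le> \<kappa> * s * (1 / 2)"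
    using \<kappa>_pos s_pos by (simp add: val ennreal_le_iff)
  then have "1 - q * p / N \<le> 1 / 2" using \<kappa>_pos s_pos by (simp only: mult_le_cancel_left_pos mult_pos_pos)
  then have "N \<le> 2 * (q * p)" using N by (simp add: field_simps)
  then show ?thesis using p unfolding N_def[symmetric] by (simp add: field_simps)
qed

end

section \<open>Choice of parameters and constants\<close>

theorem corollary5p6:
  shows "\<exists>c c' :: real. c > 0 \<and> c' > 0 \<and>
    (\<forall>L G0 DY \<sigma> \<epsilon> :: real.
       L > 0 \<and> G0 > 0 \<and> DY > 0 \<and> \<sigma> \<ge> 0 \<and>
       0 < \<epsilon> \<and> \<epsilon> \<le> c * min (sqrt (L * G0)) (L * DY) \<longrightarrow>
       (\<exists>P Q. NCC_pd L G0 DY P \<and> unbiased_oracle P (\<sigma>\<^sup>2) Q \<and>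
          (\<forall>A q. zero_respecting_algorithm P Q A \<and> expected_stationary L P Q A \<epsilon> q \<longrightarrow>
             real q \<ge> c' * (L\<^sup>2 * DY * G0 / \<epsilon> ^ 3 + L ^ 3 * DY\<^sup>2 * G0 * \<sigma>\<^sup>2 / \<epsilon> ^ 6))))"
proof (rule exI[of _ "1 / 1000"], rule exI[of _ "1 / 10 ^ 12"], intro conjI allI impI)
  fix L G0 DY \<sigma> \<epsilon> :: real
  assume "L > 0 \<and> G0 > 0 \<and> DY > 0 \<and> \<sigma> \<ge> 0 \<and> 0 < \<epsilon> \<and>
    \<epsilon> \<le> 1 / 1000 * min (sqrt (L * G0)) (L * DY)"
  then have L: "L > 0" and G0: "G0 > 0" and DY: "DY > 0" and \<sigma>: "\<sigma> \<ge> 0" and \<epsilon>: "\<epsilon> > 0"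
    and \<epsilon>1: "\<epsilon> \<le> sqrt (L * G0) / 1000" and \<epsilon>2: "\<epsilon> \<le> L * DY / 1000"
    by auto
  \<comment> \<open>\<open>u\<close> and \<open>v\<close> are the real values of \<open>T\<close>
    and \<open>n\<close> at which \<open>4 * \<kappa> * s^2 * T\<close> equals \<open>G0\<close> and
    \<open>6 * n * s\<close> equals \<open>DY\<close>, for the \<open>\<kappa>\<close> and
    \<open>s\<close> chosen below.\<close>
  define u where "u = L * G0 / (1024 * \<epsilon>\<^sup>2)"
  define v where "v = L * DY / (768 * \<epsilon>)"
  have "\<epsilon>\<^sup>2 \<le> (sqrt (L * G0) / 1000)\<^sup>2" using \<epsilon> \<epsilon>1 by (intro power_mono) auto
  also have "\<dots> = L * G0 / 1000000" using L G0 by (simp add: power_divide)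
  finally have "1024 * \<epsilon>\<^sup>2 \<le> L * G0" using zero_le_power2[of \<epsilon>] by linarith
  \<comment> \<open>The bound on \<open>\<epsilon>\<close> guarantees room for at least one link and
    one spring.\<close>
  then have u1: "u \<ge> 1" using \<epsilon> by (simp add: u_def le_divide_eq)
  have v1: "v \<ge> 1" using \<epsilon> \<epsilon>2 by (simp add: v_def le_divide_eq)
  define T where "T = nat \<lfloor>u\<rfloor>"
  define n where "n = nat \<lfloor>v\<rfloor>"
  \<comment> \<open>From 1 on, rounding down loses at most a factor 2.\<close>
  have floor: "real (nat \<lfloor>x\<rfloor>) \<le> x \<and> x / 2 \<le> real (nat \<lfloor>x\<rfloor>) \<and> nat \<lfloor>x\<rfloor> > 0" if "x \<ge> 1" for x :: real
  proof -
    have "1 \<le> \<lfloor>x\<rfloor>" using that by simp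
    moreover from this have "1 \<le> real_of_int \<lfloor>x\<rfloor>" "real (nat \<lfloor>x\<rfloor>) = real_of_int \<lfloor>x\<rfloor>" by simp_all
    ultimately show ?thesis using floor_correct[of x] by linarith
  qed
  have T: "real T \<le> u" "u / 2 \<le> real T" "T > 0" using floor[OF u1] unfolding T_def by blast+
  have n: "real n \<le> v" "v / 2 \<le> real n" "n > 0" using floor[OF v1] unfolding n_def by blast+
  \<comment> \<open>\<open>\<kappa>\<close> makes the class constant \<open>64 * \<kappa>\<close>
    equal to \<open>L\<close>; \<open>s\<close> makes the accuracy \<open>\<kappa> * s / 2\<close>
    of \<open>query_lower_bound\<close> equal to \<open>\<epsilon>\<close>.\<close>
  define \<kappa> where "\<kappa> = L / 64"
  define s where "s = 128 * \<epsilon> / L"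
  have \<kappa>s: "\<kappa> * s = 2 * \<epsilon>" and L\<kappa>: "64 * \<kappa> = L" using L by (simp_all add: \<kappa>_def s_def)
  interpret H: hard_instance s \<kappa> n T
    using L \<epsilon> T n by unfold_locales (auto simp: \<kappa>_def s_def)
  define g2 where "g2 = (\<kappa> * H.\<delta>)\<^sup>2"
  have g2: "g2 = 4 * \<epsilon>\<^sup>2 / n"
  proof -
    have "g2 = (\<kappa> * s)\<^sup>2 / n" by (simp add: g2_def H.\<delta>_def power_divide power_mult_distrib)
    then show ?thesis by (simp add: \<kappa>s power_mult_distrib)
  qed
  have g2_pos: "g2 > 0" using \<epsilon> n by (simp add: g2)
  \<comment> \<open>This is \<open>min 1 (g2 / \<sigma>^2)\<close>; testing
    \<open>\<sigma>^2 \<le> g2\<close> first covers \<open>\<sigma> = 0\<close>.\<close>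
  define p where "p = (if \<sigma>\<^sup>2 \<le> g2 then 1 else g2 / \<sigma>\<^sup>2)"
  have p: "0 < p" "p \<le> 1"
  proof -
    have "0 < g2 / \<sigma>\<^sup>2 \<and> g2 / \<sigma>\<^sup>2 \<le> 1" if "\<not> \<sigma>\<^sup>2 \<le> g2"
    proof -
      have "0 < \<sigma>\<^sup>2" "g2 \<le> \<sigma>\<^sup>2" using that g2_pos by linarith+
      then show ?thesis using g2_pos by (simp only: divide_pos_pos divide_le_eq_1_pos)
    qed
    then show "0 < p" "p \<le> 1" by (auto simp: p_def)
  qed
  have noise: "g2 * ((1 - p) / p) \<le> \<sigma>\<^sup>2"
    using g2_pos by (auto simp: p_def field_simps)
  \<comment> \<open>\<open>1 / p\<close> is the maximum of 1 and \<open>\<sigma>^2 / g2\<close>,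
    hence at least their average; this produces the two-term sum of the bound.\<close>
  have inv_p: "1 / 2 + \<sigma>\<^sup>2 / (2 * g2) \<le> 1 / p"
    using g2_pos by (auto simp: p_def field_simps)
  interpret O: hard_oracle s \<kappa> n T p \<sigma>
    using p noise by unfold_locales (auto simp: g2_def)
  have "4 * \<kappa> * s\<^sup>2 * u = G0" "6 * v * s = DY"
    using L \<epsilon> by (simp_all add: \<kappa>_def s_def u_def v_def power2_eq_square field_simps)
  moreover have "4 * \<kappa> * s\<^sup>2 * T \<le> 4 * \<kappa> * s\<^sup>2 * u" "6 * n * s \<le> 6 * v * s"
    using T n H.\<kappa>_pos H.s_pos by (auto intro!: mult_left_mono)
  ultimately have NCC: "NCC_pd L G0 DY H.instance_problem"
    using H.NCC_pd_instance[of G0 DY] by (simp add: L\<kappa>)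
  show "\<exists>P Q. NCC_pd L G0 DY P \<and> unbiased_oracle P (\<sigma>\<^sup>2) Q \<and>
      (\<forall>A q. zero_respecting_algorithm P Q A \<and> expected_stationary L P Q A \<epsilon> q \<longrightarrow>
         real q \<ge> 1 / 10 ^ 12 * (L\<^sup>2 * DY * G0 / \<epsilon> ^ 3 + L ^ 3 * DY\<^sup>2 * G0 * \<sigma>\<^sup>2 / \<epsilon> ^ 6))"
  proof (intro exI[of _ H.instance_problem] exI[of _ O.noisy_oracle] conjI allI impI NCC
      O.unbiased_noisy_oracle)
    fix A q
    assume "zero_respecting_algorithm H.instance_problem O.noisy_oracle A \<and>
      expected_stationary L H.instance_problem O.noisy_oracle A \<epsilon> q"
    then have q: "real (T * Suc n) / (2 * p) \<le> q"
      using O.query_lower_bound[of A q] by (simp add: L\<kappa> \<kappa>s)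
    have Tn: "u * v / 4 \<le> real T * real n"
      using mult_mono[OF T(2) n(2)] u1 v1 by simp
    have Tnn: "u * v\<^sup>2 / 8 \<le> real T * real n * real n"
      using mult_mono[OF Tn n(2)] u1 v1 by (simp add: power2_eq_square)
    define R where "R = \<sigma>\<^sup>2 / \<epsilon>\<^sup>2"
    have R: "R \<ge> 0" by (simp add: R_def)
    have "u * v / 16 + u * v\<^sup>2 / 8 * R / 16 \<le> real T * real n / 4 + real T * real n * real n * R / 16"
      using Tn mult_right_mono[OF Tnn R] by simp
    \<comment> \<open>\<open>g2\<close> is inversely proportional to \<open>n\<close>, which
      supplies the second factor \<open>n\<close> of the noise term.\<close>
    also have "\<dots> = real T * real n / 2 * (1 / 2 + \<sigma>\<^sup>2 / (2 * g2))"
      using n \<epsilon> by (simp add: g2 R_def field_simps power2_eq_square)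
    also have "\<dots> \<le> real T * real n / 2 * (1 / p)"
      by (intro mult_left_mono inv_p) auto
    also have "\<dots> \<le> real (T * Suc n) / (2 * p)"
      using p by (simp add: field_simps)
    also note q
    finally have lower: "u * v / 16 + u * v\<^sup>2 / 8 * R / 16 \<le> q" .
    \<comment> \<open>The constants here and in the next fact are \<open>1024 * 768\<close> and
      \<open>1024 * 768^2\<close>; divided by \<open>10 ^ 12\<close> they are below the coefficients
      1/16 and 1/128 of \<open>lower\<close>.\<close>
    have "L\<^sup>2 * DY * G0 / \<epsilon> ^ 3 = 786432 * (u * v)"
      using \<epsilon> by (simp add: u_def v_def field_simps power2_eq_square power3_eq_cube)
    moreover have "L ^ 3 * DY\<^sup>2 * G0 * \<sigma>\<^sup>2 / \<epsilon> ^ 6 = 603979776 * (u * v\<^sup>2 * R)"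
      using \<epsilon> by (simp add: u_def v_def R_def field_simps power_numeral_reduce)
    moreover have "0 \<le> u * v" "0 \<le> u * v\<^sup>2 * R" using u1 v1 R by simp_all
    ultimately show "real q \<ge> 1 / 10 ^ 12 *
        (L\<^sup>2 * DY * G0 / \<epsilon> ^ 3 + L ^ 3 * DY\<^sup>2 * G0 * \<sigma>\<^sup>2 / \<epsilon> ^ 6)"
      using lower by simp
  qed
qed simp_all

end
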